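(* Let $n\ge1$, let $\Omega\subset\mathbb{R}^{n+1}$ be open, and let $\varphi\in C^2(\Omega,\mathbb{R})$ be a function of $x_0$ only, $\varphi(x)=\varphi(x_0)$, with $\varphi''(x_0)\ge 0$. Then for every $f\in L^2(\Omega,\mathcal{A},\varphi)$ with $\int_\Omega\frac{|f|_0^2}{\varphi''}e^{-\varphi}\,dx<\infty$ there exists $u\in L^2(\Omega,\mathcal{A},\varphi)$ such that $\overline{D}u=f$ in the weak sense on $\Omega$ and $$\|u\|^2=\int_\Omega|u|_0^2e^{-\varphi}\,dx\le 2^{2n}\int_\Omega\frac{|f|_0^2}{\varphi''}e^{-\varphi}\,dx.$$
   Context: Clifford algebra: $\mathcal{A}$ is the real $2^n$-dimensional unital associative algebra generated by $e_1,\dots,e_n$ with $e_0=1$ the unit, $e_ie_j+e_je_i=0$ for $1\le i\neq j\le n$ and $e_i^2=-1$ for $1\le i\le n$; its basis is $e_A=e_{h_1}\cdots e_{h_r}$ for $A=\{h_1<\dots<h_r\}\subset\{1,\dots,n\}$, with $e_\emptyset=e_0$. The norm on $\mathcal{A}$ is $|a|_0=\big(2^n\sum_A a_A^2\big)^{1/2}$ for $a=\sum_A a_Ae_A$, $a_A\in\mathbb{R}$. Operators: points of $\mathbb{R}^{n+1}$ are $x=(x_0,\dots,x_n)$; for $g=\sum_A g_Ae_A$, $\overline{D}g=\sum_{i=0}^n\sum_A e_ie_A\partial_{x_i}g_A$ and $g\overline{D}=\sum_{i=0}^n\sum_A e_Ae_i\partial_{x_i}g_A$. For $\varphi$ depending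 on $x_0$ only, $\varphi''$ denotes its second derivative in $x_0$. Spaces: $C_0^\infty(\Omega,\mathcal{A})$ is the set of $\mathcal{A}$-valued functions all of whose components are real-valued, smooth and compactly supported in $\Omega$. $L^2(\Omega,\mathcal{A},\varphi)$ is the set of $f=\sum_A f_Ae_A:\Omega\to\mathcal{A}$ with $\int_\Omega|f_A|^2e^{-\varphi}dx<\infty$ for all $A$, with norm $\|f\|^2=\int_\Omega|f|_0^2e^{-\varphi}dx$. Weak solution: $\overline{D}u=f$ in the weak sense on $\Omega$ means $\int_\Omega\alpha f\,dx=-\int_\Omega(\alpha\overline{D})u\,dx$ for every $\alpha\in C_0^\infty(\Omega,\mathcal{A})$. Convention: where $\varphi''=0$, the quotient $|f|_0^2/\varphi''$ is $0$ if $f=0$ and $+\infty$ if $f\neq0$. *)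

theory Defs
  imports "HOL-Analysis.Analysis"
begin

section \<open>The Clifford algebra\<close>

text \<open>
  The generators are indexed by a finite linearly ordered type \<open>'n\<close>, so \<open>n = CARD('n)\<close>
  and \<open>n \<ge> 1\<close>.  An element is its family of coordinates with respect to the basis
  \<open>e\<^sub>A\<close>, \<open>A \<subseteq> {1,\<dots>,n}\<close>.  The multiplication on \<open>vec\<close> provided by the library is
  componentwise and is not used.
\<close>

type_synonym 'n clifford = "real ^ ('n set)"

definition cl_basis :: "'n set \<Rightarrow> 'n::{finite,linorder} clifford" where
  "cl_basis A = axis A 1"

text \<open>
  Sorting the word \<open>e\<^sub>A e\<^sub>B\<close> costs one sign for each pair \<open>j < i\<close> with \<open>i \<in> A\<close>, \<open>j \<in> B\<close>
  (anticommutation) and one for each \<open>i = j\<close> (as \<open>e\<^sub>i\<^sup>2 = -1\<close>).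
\<close>

definition cl_sign :: "'n::{finite,linorder} set \<Rightarrow> 'n set \<Rightarrow> real" where
  "cl_sign A B = (-1) ^ card {(i, j). i \<in> A \<and> j \<in> B \<and> j \<le> i}"

definition cl_mult :: "'n::{finite,linorder} clifford \<Rightarrow> 'n clifford \<Rightarrow> 'n clifford"
    (infixl "\<otimes>\<^sub>c" 70) where
  "a \<otimes>\<^sub>c b = (\<Sum>A\<in>UNIV. \<Sum>B\<in>UNIV. (a $ A * b $ B * cl_sign A B) *\<^sub>R cl_basis (sym_diff A B))"

text \<open>\<open>e\<^sub>0 = 1\<close> is \<open>cl_gen None\<close>, and \<open>e\<^sub>i\<close> is \<open>cl_gen (Some i)\<close>.\<close>

definition cl_gen :: "'n option \<Rightarrow> 'n::{finite,linorder} clifford" where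
  "cl_gen i = cl_basis (set_option i)"

definition cl_norm :: "'n::{finite,linorder} clifford \<Rightarrow> real" where
  "cl_norm a = sqrt (2 ^ CARD('n) * (\<Sum>A\<in>UNIV. (a $ A)\<^sup>2))"


subsection \<open>The product satisfies the defining relations\<close>

lemma cl_sign_prod: "cl_sign A B = (\<Prod>i\<in>A. \<Prod>j\<in>B. if j \<le> i then -1 else 1)"
proof -
  have "(\<Prod>i\<in>A. \<Prod>j\<in>B. if j \<le> i then -1 else (1::real))
      = (\<Prod>(i,j)\<in>A \<times> B. if j \<le> i then -1 else 1)"
    by (simp add: prod.cartesian_product)
  also have "\<dots> = (\<Prod>p\<in>{(i, j). i \<in> A \<and> j \<in> B \<and> j \<le> i}. -1)"
    by (rule prod.mono_neutral_cong_right) (auto split: if_splits)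
  finally show ?thesis by (simp add: cl_sign_def)
qed

lemma prod_sym_diff:
  fixes f :: "'a::finite \<Rightarrow> real"
  assumes "\<And>x. f x * f x = 1"
  shows "prod f (sym_diff A B) = prod f A * prod f B"
proof -
  have 1: "prod f (sym_diff A B) = prod f (A - B) * prod f (B - A)"
    by (rule prod.union_disjoint) auto
  have 2: "prod f A = prod f (A - B) * prod f (A \<inter> B)"
    by (subst prod.union_disjoint [symmetric]) (auto intro!: arg_cong [where f="prod f"])
  have 3: "prod f B = prod f (B - A) * prod f (A \<inter> B)"
    by (subst prod.union_disjoint [symmetric]) (auto intro!: arg_cong [where f="prod f"])
  have "prod f (A \<inter> B) * prod f (A \<inter> B) = 1"
    by (simp add: assms flip: prod.distrib)
  then show ?thesis
    unfolding 1 2 3 by (simp add: mult.assoc mult.left_commute)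
qed

lemma cl_sign_sym_diff_left: "cl_sign (sym_diff A B) C = cl_sign A C * cl_sign B C"
  unfolding cl_sign_prod by (rule prod_sym_diff) (auto simp flip: prod.distrib intro!: prod.neutral)

lemma cl_sign_sym_diff_right: "cl_sign A (sym_diff B C) = cl_sign A B * cl_sign A C"
proof -
  have "(\<Prod>j\<in>sym_diff B C. if j \<le> i then -1 else (1::real))
      = (\<Prod>j\<in>B. if j \<le> i then -1 else 1) * (\<Prod>j\<in>C. if j \<le> i then -1 else 1)" for i
    by (rule prod_sym_diff) simp
  then show ?thesis
    unfolding cl_sign_prod by (simp add: prod.distrib)
qed

lemma cl_basis_mult: "cl_basis A \<otimes>\<^sub>c cl_basis B = cl_sign A B *\<^sub>R cl_basis (sym_diff A B)"
proof -
  have "cl_basis A \<otimes>\<^sub>c cl_basis B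
      = (\<Sum>A'\<in>UNIV. \<Sum>B'\<in>UNIV. if A' = A then if B' = B
           then cl_sign A' B' *\<^sub>R cl_basis (sym_diff A' B') else 0 else 0)"
    unfolding cl_mult_def
    by (intro sum.cong refl) (simp add: cl_basis_def axis_def)
  also have "\<dots> = (\<Sum>A'\<in>UNIV. if A' = A then cl_sign A' B *\<^sub>R cl_basis (sym_diff A' B) else 0)"
    by (intro sum.cong refl) (simp add: sum.delta)
  finally show ?thesis by simp
qed

lemma bilinear_cl_mult: "bilinear (\<otimes>\<^sub>c)"
  unfolding bilinear_def
  by (auto intro!: linearI
      simp: cl_mult_def algebra_simps scaleR_right.sum sum.distrib scaleR_sum_right)

lemma cl_expand: "a = (\<Sum>A\<in>UNIV. a $ A *\<^sub>R cl_basis A)"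
  by (simp add: vec_eq_iff cl_basis_def axis_def if_distrib [where f="\<lambda>x. _ * x"] cong: if_cong)

lemma cl_mult_sum_left: "(\<Sum>i\<in>S. f i) \<otimes>\<^sub>c b = (\<Sum>i\<in>S. f i \<otimes>\<^sub>c b)"
  using bilinear_cl_mult by (auto simp: bilinear_def intro: linear_sum [where f="\<lambda>x. x \<otimes>\<^sub>c b"])

lemma cl_mult_sum_right: "a \<otimes>\<^sub>c (\<Sum>i\<in>S. f i) = (\<Sum>i\<in>S. a \<otimes>\<^sub>c f i)"
  using bilinear_cl_mult by (auto simp: bilinear_def intro: linear_sum [where f="\<lambda>x. a \<otimes>\<^sub>c x"])

lemma cl_mult_scaleR_left: "(r *\<^sub>R a) \<otimes>\<^sub>c b = r *\<^sub>R (a \<otimes>\<^sub>c b)"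
  by (rule bilinear_lmul [OF bilinear_cl_mult])

lemma cl_mult_scaleR_right: "a \<otimes>\<^sub>c (r *\<^sub>R b) = r *\<^sub>R (a \<otimes>\<^sub>c b)"
  by (rule bilinear_rmul [OF bilinear_cl_mult])

lemma cl_mult_assoc: "(a \<otimes>\<^sub>c b) \<otimes>\<^sub>c c = a \<otimes>\<^sub>c (b \<otimes>\<^sub>c c)"
proof -
  have basis: "(cl_basis A \<otimes>\<^sub>c cl_basis B) \<otimes>\<^sub>c cl_basis C
      = cl_basis A \<otimes>\<^sub>c (cl_basis B \<otimes>\<^sub>c cl_basis C)" for A B C :: "'a set"
  proof -
    have "sym_diff (sym_diff A B) C = sym_diff A (sym_diff B C)" by blast
    then show ?thesis
      by (simp only: cl_basis_mult cl_mult_scaleR_left cl_mult_scaleR_right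
          cl_sign_sym_diff_left cl_sign_sym_diff_right scaleR_scaleR) (simp add: mult_ac)
  qed
  show ?thesis
    by (subst (1 2) cl_expand [of a], subst (1 2) cl_expand [of b], subst (1 2) cl_expand [of c])
      (simp only: cl_mult_sum_left cl_mult_sum_right cl_mult_scaleR_left cl_mult_scaleR_right basis)
qed

lemma cl_mult_one_left: "cl_gen None \<otimes>\<^sub>c a = a"
proof -
  have "cl_gen None \<otimes>\<^sub>c cl_basis A = cl_basis A" for A :: "'a set"
    by (simp add: cl_gen_def cl_basis_mult cl_sign_prod)
  then show ?thesis
    by (subst (1 2) cl_expand [of a]) (simp only: cl_mult_sum_right cl_mult_scaleR_right)
qed

lemma cl_mult_one_right: "a \<otimes>\<^sub>c cl_gen None = a"
proof -
  have "cl_basis A \<otimes>\<^sub>c cl_gen None = cl_basis A" for A :: "'a set"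
    by (simp add: cl_gen_def cl_basis_mult cl_sign_prod)
  then show ?thesis
    by (subst (1 2) cl_expand [of a]) (simp only: cl_mult_sum_left cl_mult_scaleR_left)
qed

lemma cl_gen_square: "cl_gen (Some i) \<otimes>\<^sub>c cl_gen (Some i) = - cl_gen None"
  by (simp add: cl_gen_def cl_basis_mult cl_sign_prod)

lemma cl_gen_anticommute:
  assumes "i \<noteq> j"
  shows "cl_gen (Some i) \<otimes>\<^sub>c cl_gen (Some j) + cl_gen (Some j) \<otimes>\<^sub>c cl_gen (Some i) = 0"
proof -
  have "sym_diff {i} {j} = sym_diff {j} {i}" by blast
  then show ?thesis
    using assms by (cases i j rule: linorder_cases)
      (auto simp: cl_gen_def cl_basis_mult cl_sign_prod not_le)
qed

lemma cl_basis_eq_word: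
  "cl_basis A = foldr (\<lambda>i a. cl_gen (Some i) \<otimes>\<^sub>c a) (sorted_list_of_set A) (cl_gen None)"
proof -
  have "foldr (\<lambda>i a. cl_gen (Some i) \<otimes>\<^sub>c a) xs (cl_gen None) = cl_basis (set xs)"
    if "sorted_wrt (<) xs" for xs :: "'a list"
    using that
  proof (induction xs)
    case Nil
    then show ?case by (simp add: cl_gen_def)
  next
    case (Cons x xs)
    have "sym_diff {x} (set xs) = insert x (set xs)"
      using Cons.prems by auto
    moreover have "cl_sign {x} (set xs) = 1"
      using Cons.prems unfolding cl_sign_prod by (auto intro!: prod.neutral)
    ultimately show ?case
      using Cons by (simp add: cl_gen_def cl_basis_mult)
  qed
  from this [of "sorted_list_of_set A"] show ?thesis by simp
qed


section \<open>Differentiation\<close>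

text \<open>\<open>\<real>\<^sup>n\<^sup>+\<^sup>1\<close> is \<open>real ^ 'n option\<close>; the coordinate \<open>x\<^sub>0\<close> is \<open>x $ None\<close>.\<close>

definition partial :: "'m \<Rightarrow> (real ^ 'm \<Rightarrow> real) \<Rightarrow> real ^ 'm \<Rightarrow> real" where
  "partial i g x = deriv (\<lambda>t. g (x + t *\<^sub>R axis i 1)) 0"

text \<open>\<open>C_on k \<Omega> g\<close> is \<open>g \<in> C\<^sup>k(\<Omega>)\<close>, meant for open \<open>\<Omega>\<close>.\<close>

primrec C_on :: "nat \<Rightarrow> (real ^ 'm) set \<Rightarrow> (real ^ 'm \<Rightarrow> real) \<Rightarrow> bool" where
  "C_on 0 \<Omega> g \<longleftrightarrow> continuous_on \<Omega> g"
| "C_on (Suc k) \<Omega> g \<longleftrightarrow> g differentiable_on \<Omega> \<and> (\<forall>i. C_on k \<Omega> (partial i g))"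

text \<open>Functions in \<open>C\<^sub>0\<^sup>\<infinity>(\<Omega>, \<A>)\<close>, extended by zero outside \<open>\<Omega>\<close>.\<close>

definition test_functions ::
  "(real ^ 'n option) set \<Rightarrow> (real ^ 'n option \<Rightarrow> 'n::{finite,linorder} clifford) set" where
  "test_functions \<Omega> = {\<alpha>. \<forall>A. (\<forall>k. C_on k UNIV (\<lambda>x. \<alpha> x $ A)) \<and>
     compact (closure {x. \<alpha> x $ A \<noteq> 0}) \<and> closure {x. \<alpha> x $ A \<noteq> 0} \<subseteq> \<Omega>}"

text \<open>The right action \<open>g \<mapsto> g D\<close> of the (conjugated) Dirac operator.\<close>

definition Dbar_right ::
  "(real ^ 'n option \<Rightarrow> 'n clifford) \<Rightarrow> real ^ 'n option \<Rightarrow> 'n::{finite,linorder} clifford" where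
  "Dbar_right g x = (\<Sum>i\<in>UNIV. \<Sum>A\<in>UNIV. partial i (\<lambda>y. g y $ A) x *\<^sub>R (cl_basis A \<otimes>\<^sub>c cl_gen i))"

definition weak_Dbar_solution ::
  "(real ^ 'n option) set \<Rightarrow> (real ^ 'n option \<Rightarrow> 'n clifford) \<Rightarrow>
   (real ^ 'n option \<Rightarrow> 'n::{finite,linorder} clifford) \<Rightarrow> bool" where
  "weak_Dbar_solution \<Omega> u f \<longleftrightarrow> (\<forall>\<alpha>\<in>test_functions \<Omega>.
     (LINT x|lebesgue_on \<Omega>. \<alpha> x \<otimes>\<^sub>c f x) = - (LINT x|lebesgue_on \<Omega>. Dbar_right \<alpha> x \<otimes>\<^sub>c u x))"


section \<open>Weighted spaces\<close>

definition L2 ::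
  "(real ^ 'n option) set \<Rightarrow> (real ^ 'n option \<Rightarrow> real) \<Rightarrow>
   (real ^ 'n option \<Rightarrow> 'n::{finite,linorder} clifford) set" where
  "L2 \<Omega> \<phi> = {f \<in> borel_measurable (lebesgue_on \<Omega>).
     \<forall>A. (\<integral>\<^sup>+x. ennreal (\<bar>f x $ A\<bar>\<^sup>2 * exp (- \<phi> x)) \<partial>lebesgue_on \<Omega>) < \<infinity>}"

definition L2_norm ::
  "(real ^ 'n option) set \<Rightarrow> (real ^ 'n option \<Rightarrow> real) \<Rightarrow>
   (real ^ 'n option \<Rightarrow> 'n::{finite,linorder} clifford) \<Rightarrow> real" where
  "L2_norm \<Omega> \<phi> f = sqrt (LINT x|lebesgue_on \<Omega>. (cl_norm (f x))\<^sup>2 * exp (- \<phi> x))"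

text \<open>
  \<open>\<integral>\<^sub>\<Omega> |f|\<^sub>0\<^sup>2 / w e\<^sup>-\<^sup>\<phi> dx\<close>.  Division on \<open>ennreal\<close> has \<open>0 / 0 = 0\<close> and \<open>c / 0 = \<infinity>\<close> for
  \<open>c > 0\<close>, which is the convention wanted where \<open>w = 0\<close>.
\<close>

definition weighted_energy ::
  "(real ^ 'n option) set \<Rightarrow> (real ^ 'n option \<Rightarrow> real) \<Rightarrow> (real ^ 'n option \<Rightarrow> real) \<Rightarrow>
   (real ^ 'n option \<Rightarrow> 'n::{finite,linorder} clifford) \<Rightarrow> ennreal" where
  "weighted_energy \<Omega> \<phi> w f =
     (\<integral>\<^sup>+x. ennreal ((cl_norm (f x))\<^sup>2) / ennreal (w x) * ennreal (exp (- \<phi> x)) \<partial>lebesgue_on \<Omega>)"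

end

theory Submission
  imports Defs
begin

text \<open>
  Hoermander's duality method.  Write \<open>\<partial>\<^sub>i\<close> for the partial derivatives and let
  \<open>P\<alpha> = \<Sum>\<^sub>j \<partial>\<^sub>j\<alpha> e\<^sub>j\<close> over \<open>j \<ge> 1\<close>, so that the operator is \<open>\<alpha> \<mapsto> \<partial>\<^sub>0\<alpha> + P\<alpha>\<close>.
  Right multiplication by \<open>e\<^sub>j\<close> is skew, hence \<open>P\<close> is symmetric and commutes with \<open>\<partial>\<^sub>0\<close> and, as
  \<open>\<phi>\<close> depends on \<open>x\<^sub>0\<close> only, with multiplication by \<open>e\<^sup>\<phi>\<close> and \<open>\<phi>'\<close>.  Conjugating with
  \<open>e\<^bsup>\<phi>/2\<^esup>\<close> turns the operator into \<open>\<partial>\<^sub>0 + (P - \<phi>'/2)\<close>, a skew plus a symmetric part, whose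
  commutator contributes \<open>\<phi>''/2\<close>; therefore
  \<open>\<integral> \<phi>'' |\<alpha>|\<^sup>2 e\<^sup>\<phi> \<le> 2 \<integral> |\<partial>\<^sub>0\<alpha> + P\<alpha>|\<^sup>2 e\<^sup>\<phi>\<close> for all test functions.  By Cauchy--Schwarz the
  functional \<open>\<alpha> \<mapsto> - \<integral> \<alpha> f\<close> (scalar part) is then bounded in terms of the weighted norm of
  \<open>\<partial>\<^sub>0\<alpha> + P\<alpha>\<close>, and Riesz representation yields \<open>u\<close> with constant \<open>2 \<le> 2\<^bsup>2n\<^esup>\<close>.
\<close>

section \<open>Riesz representation in \<open>L\<^sup>2\<close>\<close>

lemma quadratic_nonneg_imp_discriminant:
  fixes a b c :: real
  assumes "\<And>t. 0 \<le> a + 2 * t * b + t\<^sup>2 * c" and "0 \<le> c"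
  shows "b\<^sup>2 \<le> a * c"
proof (cases "c = 0")
  case True
  have "b = 0"
  proof (rule ccontr)
    assume "b \<noteq> 0"
    then show False
      \<comment> \<open>With \<open>c = 0\<close> the expression is affine in \<open>t\<close>; this
        \<open>t\<close> gives it the value -1.\<close>
      using assms(1) [of "- (a + 1) / (2 * b)"] True by (simp add: field_simps)
  qed
  with True show ?thesis by simp
next
  case False
  with \<open>0 \<le> c\<close> have "c > 0" by simp
  \<comment> \<open>The minimum of the quadratic is attained at \<open>t = - b / c\<close>.\<close>
  have "0 \<le> a + 2 * (- b / c) * b + (- b / c)\<^sup>2 * c" by (rule assms)
  also have "\<dots> = a - b\<^sup>2 / c"
    using \<open>c > 0\<close> by (simp add: power2_eq_square field_simps)
  finally show ?thesis
    using \<open>c > 0\<close> by (simp add: field_simps)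
qed

lemma integrable_inner_L2:
  fixes v w :: "'a \<Rightarrow> 'b::euclidean_space"
  assumes "v \<in> borel_measurable M" "w \<in> borel_measurable M"
    and "integrable M (\<lambda>x. (norm (v x))\<^sup>2)" "integrable M (\<lambda>x. (norm (w x))\<^sup>2)"
  shows "integrable M (\<lambda>x. v x \<bullet> w x)"
proof (rule Bochner_Integration.integrable_bound)
  show "integrable M (\<lambda>x. (norm (v x))\<^sup>2 + (norm (w x))\<^sup>2)"
    using assms by simp
  show "(\<lambda>x. v x \<bullet> w x) \<in> borel_measurable M"
    using assms by measurable
  have "norm (v x \<bullet> w x) \<le> norm ((norm (v x))\<^sup>2 + (norm (w x))\<^sup>2)" for x
  proof -
    have "\<bar>v x \<bullet> w x\<bar> \<le> norm (v x) * norm (w x)" by (rule Cauchy_Schwarz_ineq2)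
    also have "\<dots> \<le> (norm (v x))\<^sup>2 + (norm (w x))\<^sup>2"
      using sum_squares_bound [of "norm (v x)" "norm (w x)"]
        mult_nonneg_nonneg [OF norm_ge_zero [of "v x"] norm_ge_zero [of "w x"]] by linarith
    finally show ?thesis by simp
  qed
  then show "AE x in M. norm (v x \<bullet> w x) \<le> norm ((norm (v x))\<^sup>2 + (norm (w x))\<^sup>2)" by simp
qed

text \<open>Expanding the square pointwise, with the mixed term integrable by
  \<open>integrable_inner_L2\<close>. The choices \<open>(1, t)\<close>, \<open>(1/2, 1/2)\<close>
  and \<open>(1, -1)\<close> of \<open>(a, b)\<close> serve Cauchy-Schwarz, first variations,
  midpoints and differences.\<close>

lemma
  fixes v w :: "'a \<Rightarrow> 'b::euclidean_space"
  assumes "v \<in> borel_measurable M" "w \<in> borel_measurable M"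
    and "integrable M (\<lambda>x. (norm (v x))\<^sup>2)" "integrable M (\<lambda>x. (norm (w x))\<^sup>2)"
  shows integrable_norm_square_combination:
      "integrable M (\<lambda>x. (norm (a *\<^sub>R v x + b *\<^sub>R w x))\<^sup>2)"
    and integral_norm_square_combination:
      "(LINT x|M. (norm (a *\<^sub>R v x + b *\<^sub>R w x))\<^sup>2) =
        a\<^sup>2 * (LINT x|M. (norm (v x))\<^sup>2) + 2 * a * b * (LINT x|M. v x \<bullet> w x)
        + b\<^sup>2 * (LINT x|M. (norm (w x))\<^sup>2)"
proof -
  have *: "(norm (a *\<^sub>R v x + b *\<^sub>R w x))\<^sup>2
      = a\<^sup>2 * (norm (v x))\<^sup>2 + 2 * a * b * (v x \<bullet> w x) + b\<^sup>2 * (norm (w x))\<^sup>2" for x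
    unfolding power2_norm_eq_inner
    by (simp add: inner_add_left inner_add_right inner_commute power2_eq_square algebra_simps)
  note int = integrable_inner_L2 [OF assms] assms(3,4)
  show "integrable M (\<lambda>x. (norm (a *\<^sub>R v x + b *\<^sub>R w x))\<^sup>2)"
    unfolding * using int by simp
  show "(LINT x|M. (norm (a *\<^sub>R v x + b *\<^sub>R w x))\<^sup>2) =
      a\<^sup>2 * (LINT x|M. (norm (v x))\<^sup>2) + 2 * a * b * (LINT x|M. v x \<bullet> w x)
      + b\<^sup>2 * (LINT x|M. (norm (w x))\<^sup>2)"
    unfolding * using int by simp
qed

lemma Cauchy_Schwarz_L2:
  fixes v w :: "'a \<Rightarrow> 'b::euclidean_space"
  assumes "v \<in> borel_measurable M" "w \<in> borel_measurable M"
    and "integrable M (\<lambda>x. (norm (v x))\<^sup>2)" "integrable M (\<lambda>x. (norm (w x))\<^sup>2)"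
  shows "(LINT x|M. v x \<bullet> w x)\<^sup>2 \<le> (LINT x|M. (norm (v x))\<^sup>2) * (LINT x|M. (norm (w x))\<^sup>2)"
proof (rule quadratic_nonneg_imp_discriminant)
  fix t :: real
  have "0 \<le> (LINT x|M. (norm (1 *\<^sub>R v x + t *\<^sub>R w x))\<^sup>2)" by simp
  then show "0 \<le> (LINT x|M. (norm (v x))\<^sup>2) + 2 * t * (LINT x|M. v x \<bullet> w x)
      + t\<^sup>2 * (LINT x|M. (norm (w x))\<^sup>2)"
    unfolding integral_norm_square_combination [OF assms] by simp
qed simp

text \<open>Riesz-Fischer: a rapidly Cauchy subsequence converges almost everywhere, and Fatou's
  lemma upgrades this to mean-square convergence of the whole sequence. Extended nonnegative
  integrals allow all this before square-integrability of the limit is known.\<close>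

lemma L2_complete:
  fixes F :: "nat \<Rightarrow> 'a \<Rightarrow> 'b::{banach, second_countable_topology}"
  assumes F[measurable]: "\<And>n. F n \<in> borel_measurable M"
    and Cauchy: "\<And>e. 0 < e \<Longrightarrow>
      \<exists>N. \<forall>m\<ge>N. \<forall>n\<ge>N. (\<integral>\<^sup>+x. ennreal ((norm (F m x - F n x))\<^sup>2) \<partial>M) \<le> ennreal e"
  obtains g where "g \<in> borel_measurable M"
    and "\<And>e. 0 < e \<Longrightarrow>
      \<exists>N. \<forall>n\<ge>N. (\<integral>\<^sup>+x. ennreal ((norm (F n x - g x))\<^sup>2) \<partial>M) \<le> ennreal e"
proof -
  \<comment> \<open>The rate \<open>(1/4) ^ k\<close> stays summable after the weight
    \<open>2 ^ k\<close> introduced below.\<close>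
  have "\<exists>N. \<forall>m\<ge>N. \<forall>n\<ge>N. (\<integral>\<^sup>+x. ennreal ((norm (F m x - F n x))\<^sup>2) \<partial>M) \<le> ennreal ((1/4) ^ k)"
    for k :: nat
    by (rule Cauchy) simp
  then obtain N where N: "\<And>k m n. m \<ge> N k \<Longrightarrow> n \<ge> N k \<Longrightarrow>
      (\<integral>\<^sup>+x. ennreal ((norm (F m x - F n x))\<^sup>2) \<partial>M) \<le> ennreal ((1/4) ^ k)"
    by metis
  \<comment> \<open>The sum puts both \<open>r k\<close> and \<open>r (Suc k)\<close> beyond
    \<open>N k\<close>; the summand \<open>k\<close> forces \<open>r\<close> to infinity.\<close>
  define r where "r k = k + (\<Sum>j\<le>k. N j)" for k
  have r1: "r k \<ge> N k" for k
    unfolding r_def by (rule trans_le_add2) (rule member_le_sum, auto)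
  have r2: "r (Suc k) \<ge> N k" for k
    unfolding r_def by (rule trans_le_add2) (rule member_le_sum, auto)
  define d where "d k x = F (r (Suc k)) x - F (r k) x" for k x
  have d[measurable]: "d k \<in> borel_measurable M" for k
    unfolding d_def by measurable
  have "(\<integral>\<^sup>+x. (\<Sum>k. ennreal (2 ^ k * (norm (d k x))\<^sup>2)) \<partial>M)
      = (\<Sum>k. \<integral>\<^sup>+x. ennreal (2 ^ k * (norm (d k x))\<^sup>2) \<partial>M)"
    by (rule nn_integral_suminf) measurable
  also have "\<dots> \<le> (\<Sum>k. ennreal ((1/2) ^ k))"
  proof (rule suminf_le)
    fix k
    have "(\<integral>\<^sup>+x. ennreal (2 ^ k * (norm (d k x))\<^sup>2) \<partial>M)
        = ennreal (2 ^ k) * (\<integral>\<^sup>+x. ennreal ((norm (d k x))\<^sup>2) \<partial>M)"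
      by (subst nn_integral_cmult [symmetric]) (auto simp: ennreal_mult)
    also have "\<dots> \<le> ennreal (2 ^ k) * ennreal ((1/4) ^ k)"
      unfolding d_def by (intro mult_left_mono N r1 r2) simp
    also have "\<dots> = ennreal ((1/2) ^ k)"
      by (simp flip: ennreal_mult power_mult_distrib)
    finally show "(\<integral>\<^sup>+x. ennreal (2 ^ k * (norm (d k x))\<^sup>2) \<partial>M) \<le> ennreal ((1/2) ^ k)" .
  qed auto
  also have "\<dots> < \<infinity>"
    by (subst suminf_ennreal2) (auto simp: summable_geometric)
  finally have "AE x in M. (\<Sum>k. ennreal (2 ^ k * (norm (d k x))\<^sup>2)) \<noteq> \<infinity>"
    by (intro nn_integral_PInf_AE) auto
  then have conv: "AE x in M. convergent (\<lambda>k. F (r k) x)"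
  proof eventually_elim
    case (elim x)
    then have "summable (\<lambda>k. 2 ^ k * (norm (d k x))\<^sup>2)"
      by (intro summable_suminf_not_top) auto
    then have s: "summable (\<lambda>k. (1/2) ^ k + 2 ^ k * (norm (d k x))\<^sup>2)"
      by (intro summable_add summable_geometric) auto
    \<comment> \<open>An arithmetic-geometric mean bound: it turns summability of weighted squares
      into absolute summability of the increments.\<close>
    have "norm (d k x) \<le> (1/2) ^ k + 2 ^ k * (norm (d k x))\<^sup>2" for k
    proof -
      define a where "a = norm (d k x)"
      define q :: real where "q = 2 ^ k"
      have q: "q > 0" by (simp add: q_def)
      have "2 * (q * a) * 1 \<le> (q * a)\<^sup>2 + 1\<^sup>2"
        by (rule sum_squares_bound)
      moreover have "0 \<le> (q * a)\<^sup>2" by simp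
      ultimately have "q * a \<le> 1 + (q * a)\<^sup>2" unfolding one_power2 by linarith
      then have "a \<le> 1 / q + q * a\<^sup>2"
        using q by (simp add: field_simps power2_eq_square)
      then show ?thesis by (simp add: a_def q_def power_one_over)
    qed
    then have "summable (\<lambda>k. d k x)"
      by (intro summable_comparison_test' [OF s, of 0])
    then have "convergent (\<lambda>n. \<Sum>k<n. d k x)"
      by (simp add: summable_iff_convergent)
    then have "convergent (\<lambda>n. F (r n) x - F (r 0) x)"
      unfolding d_def by (subst (asm) sum_lessThan_telescope)
    then have "convergent (\<lambda>n. (F (r n) x - F (r 0) x) + F (r 0) x)"
      by (intro convergent_add convergent_const)
    then show ?case by simp
  qed
  \<comment> \<open>Where the subsequence diverges the value of \<open>lim\<close> is unspecified,
    but that set is null and \<open>g\<close> is measurable all the same.\<close>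
  define g where "g x = lim (\<lambda>k. F (r k) x)" for x
  have g[measurable]: "g \<in> borel_measurable M"
    unfolding g_def by (rule borel_measurable_lim_metric) measurable
  have "\<exists>N. \<forall>n\<ge>N. (\<integral>\<^sup>+x. ennreal ((norm (F n x - g x))\<^sup>2) \<partial>M) \<le> ennreal e" if "0 < e" for e
  proof -
    obtain N where N: "\<And>m n. m \<ge> N \<Longrightarrow> n \<ge> N \<Longrightarrow>
        (\<integral>\<^sup>+x. ennreal ((norm (F m x - F n x))\<^sup>2) \<partial>M) \<le> ennreal e"
      using Cauchy [OF \<open>0 < e\<close>] by blast
    have "(\<integral>\<^sup>+x. ennreal ((norm (F n x - g x))\<^sup>2) \<partial>M) \<le> ennreal e" if "n \<ge> N" for n
    proof -
      \<comment> \<open>Fatou's lemma with \<open>n\<close> fixed and \<open>j\<close> running along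
        the subsequence.\<close>
      have "(\<integral>\<^sup>+x. ennreal ((norm (F n x - g x))\<^sup>2) \<partial>M)
          = (\<integral>\<^sup>+x. liminf (\<lambda>j. ennreal ((norm (F n x - F (r j) x))\<^sup>2)) \<partial>M)"
      proof (rule nn_integral_cong_AE)
        show "AE x in M. ennreal ((norm (F n x - g x))\<^sup>2)
            = liminf (\<lambda>j. ennreal ((norm (F n x - F (r j) x))\<^sup>2))"
          using conv
        proof eventually_elim
          case (elim x)
          then have "(\<lambda>j. F (r j) x) \<longlonglongrightarrow> g x"
            unfolding g_def by (simp add: convergent_LIMSEQ_iff)
          then have "(\<lambda>j. ennreal ((norm (F n x - F (r j) x))\<^sup>2))
              \<longlonglongrightarrow> ennreal ((norm (F n x - g x))\<^sup>2)"
            by (intro tendsto_ennrealI tendsto_intros)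
          from lim_imp_Liminf [OF _ this] show ?case by simp
        qed
      qed
      also have "\<dots> \<le> liminf (\<lambda>j. \<integral>\<^sup>+x. ennreal ((norm (F n x - F (r j) x))\<^sup>2) \<partial>M)"
        by (rule nn_integral_liminf) measurable
      also have "\<dots> \<le> liminf (\<lambda>j. ennreal e)"
      proof (rule Liminf_mono)
        show "\<forall>\<^sub>F j in sequentially.
            (\<integral>\<^sup>+x. ennreal ((norm (F n x - F (r j) x))\<^sup>2) \<partial>M) \<le> ennreal e"
          using eventually_ge_at_top [of N]
        proof eventually_elim
          case (elim j)
          then have "r j \<ge> N" by (simp add: r_def)
          with N \<open>n \<ge> N\<close> show ?case by blast
        qed
      qed
      also have "\<dots> = ennreal e" by (simp add: Liminf_const)
      finally show ?thesis .
    qed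
    then show ?thesis by blast
  qed
  with g show thesis by (rule that)
qed

text \<open>
  The functional is given as a set of pairs (vector, value).  Its representative is the limit of
  a minimizing sequence for \<open>\<parallel>v\<parallel>\<^sup>2 - 2r\<close>, which is Cauchy by the parallelogram law.
\<close>

lemma L2_Riesz:
  fixes S :: "(('a \<Rightarrow> 'b::euclidean_space) \<times> real) set"
  assumes meas: "\<And>v r. (v, r) \<in> S \<Longrightarrow> v \<in> borel_measurable M"
    and int: "\<And>v r. (v, r) \<in> S \<Longrightarrow> integrable M (\<lambda>x. (norm (v x))\<^sup>2)"
    and comb: "\<And>v r w s a b. (v, r) \<in> S \<Longrightarrow> (w, s) \<in> S \<Longrightarrow>
      ((\<lambda>x. a *\<^sub>R v x + b *\<^sub>R w x), a * r + b * s) \<in> S"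
    and "S \<noteq> {}" and "0 \<le> C"
    and bound: "\<And>v r. (v, r) \<in> S \<Longrightarrow> r\<^sup>2 \<le> C * (LINT x|M. (norm (v x))\<^sup>2)"
  obtains g where "g \<in> borel_measurable M" and "integrable M (\<lambda>x. (norm (g x))\<^sup>2)"
    and "(LINT x|M. (norm (g x))\<^sup>2) \<le> C"
    and "\<And>v r. (v, r) \<in> S \<Longrightarrow> (LINT x|M. v x \<bullet> g x) = r"
proof -
  define Q where "Q v = (LINT x|M. (norm (v x))\<^sup>2)" for v :: "'a \<Rightarrow> 'b"
  define B where "B v w = (LINT x|M. v x \<bullet> w x)" for v w :: "'a \<Rightarrow> 'b"
  \<comment> \<open>If \<open>g\<close> represents the functional, \<open>J\<close> is the squared
    distance to \<open>g\<close> minus the constant \<open>Q g\<close>, so minimizing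
    \<open>J\<close> approximates \<open>g\<close>.\<close>
  define J where "J p = Q (fst p) - 2 * snd p" for p
  have Q0: "0 \<le> Q v" for v by (simp add: Q_def)
  \<comment> \<open>From \<open>bound\<close>, the square of \<open>2 * r\<close> is at most
    \<open>4 * (C * Q v)\<close>, hence at most the square of \<open>C + Q v\<close>.\<close>
  have J_bound: "- C \<le> J p" if "p \<in> S" for p
  proof -
    obtain v r where p: "p = (v, r)" by (cases p)
    have "r\<^sup>2 \<le> C * Q v" using bound that unfolding p Q_def by blast
    moreover have "4 * (C * Q v) \<le> (C + Q v)\<^sup>2"
      using sum_squares_bound [of C "Q v"] by (simp add: power2_sum)
    moreover have "(2 * r)\<^sup>2 = 4 * r\<^sup>2" by (simp add: power_mult_distrib)
    ultimately have "(2 * r)\<^sup>2 \<le> (C + Q v)\<^sup>2" by linarith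
    then have "2 * r \<le> C + Q v"
      using \<open>0 \<le> C\<close> Q0 [of v] power2_le_imp_le [of "2 * r" "C + Q v"] by linarith
    then show ?thesis by (simp add: J_def p)
  qed
  define m where "m = Inf (J ` S)"
  have bdd: "bdd_below (J ` S)" using J_bound by (rule bdd_belowI2)
  have m_le: "m \<le> J p" if "p \<in> S" for p
    unfolding m_def using that by (intro cInf_lower bdd) auto
  have "\<exists>p\<in>S. J p < m + 1 / real (Suc k)" for k
    using cInf_lessD [of "J ` S" "m + 1 / real (Suc k)"] \<open>S \<noteq> {}\<close> by (auto simp: m_def)
  then obtain p where p: "\<And>k. p k \<in> S" "\<And>k. J (p k) < m + 1 / real (Suc k)" by metis
  define V where "V k = fst (p k)" for k
  define R where "R k = snd (p k)" for k
  have VR: "(V k, R k) \<in> S" for k using p(1) by (simp add: V_def R_def)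
  have JVR: "Q (V k) - 2 * R k < m + 1 / real (Suc k)" for k
    using p(2) by (simp add: V_def R_def J_def)
  note VM[measurable] = meas [OF VR]
  note VI = int [OF VR]
  have lin: "Q (\<lambda>x. a *\<^sub>R V k x + b *\<^sub>R w x) = a\<^sup>2 * Q (V k) + 2 * a * b * B (V k) w + b\<^sup>2 * Q w"
    if "(w, s) \<in> S" for a b k w s
    unfolding Q_def B_def
    using integral_norm_square_combination [OF VM meas [OF that] VI int [OF that]] .
  \<comment> \<open>The midpoint of two members of the sequence belongs to \<open>S\<close>, so
    \<open>J\<close> is at least \<open>m\<close> there; the parallelogram law then bounds the
    difference.\<close>
  have diff: "Q (\<lambda>x. V j x - V k x) \<le> 2 / real (Suc j) + 2 / real (Suc k)" for j k
  proof -
    have "m \<le> Q (\<lambda>x. (1/2) *\<^sub>R V j x + (1/2) *\<^sub>R V k x) - 2 * ((1/2) * R j + (1/2) * R k)"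
      using m_le [OF comb [OF VR [of j] VR [of k], of "1/2" "1/2"]] by (simp add: J_def)
    also have "\<dots> = Q (V j) / 4 + B (V j) (V k) / 2 + Q (V k) / 4 - R j - R k"
      by (subst lin [OF VR]) (simp add: power2_eq_square)
    finally have "m \<le> Q (V j) / 4 + B (V j) (V k) / 2 + Q (V k) / 4 - R j - R k" .
    moreover have "Q (\<lambda>x. V j x - V k x) = Q (V j) - 2 * B (V j) (V k) + Q (V k)"
      using lin [OF VR, of 1 j "-1" k] by simp
    ultimately show ?thesis using JVR [of j] JVR [of k] by linarith
  qed
  have intdiff: "integrable M (\<lambda>x. (norm (V j x - V k x))\<^sup>2)" for j k
    using integrable_norm_square_combination [OF VM VM VI VI, of 1 j "-1" k] by simp
  have small: "2 / real (Suc n) \<le> e" if "n \<ge> nat \<lceil>2 / e\<rceil>" "e > 0" for n and e :: real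
  proof -
    have "2 / e \<le> real (nat \<lceil>2 / e\<rceil>)" by linarith
    also have "\<dots> \<le> real (Suc n)" using that(1) by linarith
    finally show ?thesis using that by (simp add: field_simps)
  qed
  obtain g where g[measurable]: "g \<in> borel_measurable M"
    and lim: "\<And>e. e > 0 \<Longrightarrow>
      \<exists>N. \<forall>n\<ge>N. (\<integral>\<^sup>+x. ennreal ((norm (V n x - g x))\<^sup>2) \<partial>M) \<le> ennreal e"
  proof (rule L2_complete [of V M])
    fix e :: real assume "e > 0"
    have "(\<integral>\<^sup>+x. ennreal ((norm (V j x - V k x))\<^sup>2) \<partial>M) \<le> ennreal e"
      if "j \<ge> nat \<lceil>2 / (e/2)\<rceil>" "k \<ge> nat \<lceil>2 / (e/2)\<rceil>" for j k
    proof -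
      have "Q (\<lambda>x. V j x - V k x) \<le> e"
        using diff [of j k] small [OF that(1)] small [OF that(2)] \<open>e > 0\<close> by simp
      then show ?thesis
        by (subst nn_integral_eq_integral [OF intdiff]) (auto simp: Q_def intro: ennreal_leI)
    qed
    then show "\<exists>N. \<forall>m\<ge>N. \<forall>n\<ge>N.
        (\<integral>\<^sup>+x. ennreal ((norm (V m x - V n x))\<^sup>2) \<partial>M) \<le> ennreal e" by blast
  qed (use that in measurable)
  have intVg: "\<exists>N. \<forall>n\<ge>N. integrable M (\<lambda>x. (norm (V n x - g x))\<^sup>2) \<and> Q (\<lambda>x. V n x - g x) \<le> e"
    if "e > 0" for e
  proof -
    obtain N where N: "\<And>n. n \<ge> N \<Longrightarrow>
        (\<integral>\<^sup>+x. ennreal ((norm (V n x - g x))\<^sup>2) \<partial>M) \<le> ennreal e"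
      using lim [OF \<open>e > 0\<close>] by blast
    have "integrable M (\<lambda>x. (norm (V n x - g x))\<^sup>2) \<and> Q (\<lambda>x. V n x - g x) \<le> e" if "n \<ge> N" for n
    proof
      show i: "integrable M (\<lambda>x. (norm (V n x - g x))\<^sup>2)"
        by (rule integrableI_nonneg) (use N [OF that] in \<open>auto intro: le_less_trans\<close>)
      show "Q (\<lambda>x. V n x - g x) \<le> e"
        using N [OF that] \<open>e > 0\<close> unfolding nn_integral_eq_integral [OF i, simplified] Q_def by simp
    qed
    then show ?thesis by blast
  qed
  obtain N where N: "\<And>n. n \<ge> N \<Longrightarrow> integrable M (\<lambda>x. (norm (V n x - g x))\<^sup>2)"
    using intVg [of 1] by auto
  have dM: "(\<lambda>x. V n x - g x) \<in> borel_measurable M" for n by measurable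
  \<comment> \<open>One good index suffices, as \<open>g\<close> is \<open>V N\<close> minus
    \<open>V N - g\<close>.\<close>
  have gI: "integrable M (\<lambda>x. (norm (g x))\<^sup>2)"
    using integrable_norm_square_combination [OF VM dM VI N [OF order_refl], of 1 N "-1"] by simp
  have dI: "integrable M (\<lambda>x. (norm (V n x - g x))\<^sup>2)" for n
    using integrable_norm_square_combination [OF VM g VI gI, of 1 n "-1"] by simp
  have Qlim: "(\<lambda>n. Q (\<lambda>x. V n x - g x)) \<longlonglongrightarrow> 0"
  proof (rule LIMSEQ_I)
    fix e :: real assume "e > 0"
    with intVg [of "e/2"] obtain N where "\<And>n. n \<ge> N \<Longrightarrow> Q (\<lambda>x. V n x - g x) \<le> e / 2" by auto
    then have "norm (Q (\<lambda>x. V n x - g x) - 0) < e" if "n \<ge> N" for n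
      using that \<open>e > 0\<close> Q0 [of "\<lambda>x. V n x - g x"] by fastforce
    then show "\<exists>N. \<forall>n\<ge>N. norm (Q (\<lambda>x. V n x - g x) - 0) < e" by blast
  qed
  have Blim: "(\<lambda>n. B (V n) w) \<longlonglongrightarrow> B g w"
    if w: "w \<in> borel_measurable M" "integrable M (\<lambda>x. (norm (w x))\<^sup>2)" for w
  proof -
    have "(\<lambda>n. (B (V n) w - B g w)\<^sup>2) \<longlonglongrightarrow> 0"
    proof (rule tendsto_sandwich [OF _ _ tendsto_const])
      have "B (V n) w - B g w = (LINT x|M. (V n x - g x) \<bullet> w x)" for n
        unfolding B_def inner_diff_left
        by (rule Bochner_Integration.integral_diff [symmetric])
          (auto intro: integrable_inner_L2 VM VI g gI w)
      then have "(B (V n) w - B g w)\<^sup>2 \<le> Q (\<lambda>x. V n x - g x) * Q w" for n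
        using Cauchy_Schwarz_L2 [OF dM w(1) dI w(2), of n] by (simp add: Q_def)
      then show "\<forall>\<^sub>F n in sequentially. (B (V n) w - B g w)\<^sup>2 \<le> Q (\<lambda>x. V n x - g x) * Q w" by simp
      show "(\<lambda>n. Q (\<lambda>x. V n x - g x) * Q w) \<longlonglongrightarrow> 0"
        using tendsto_mult_right [OF Qlim, of "Q w"] by simp
    qed simp
    then have "(\<lambda>n. B (V n) w - B g w) \<longlonglongrightarrow> 0" by simp
    then show ?thesis by (simp add: LIM_zero_iff)
  qed
  \<comment> \<open>First variation: moving from \<open>V k\<close> by \<open>t\<close> times
    \<open>w\<close> cannot push \<open>J\<close> below \<open>m\<close>, and \<open>V k\<close> is
    within \<open>1 / real (Suc k)\<close> of \<open>m\<close>. The discriminant of this quadratic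
    in \<open>t\<close> bounds the error.\<close>
  have repr: "B g w = s" if w: "(w, s) \<in> S" for w s
  proof -
    have "(B (V k) w - s)\<^sup>2 \<le> 1 / real (Suc k) * Q w" for k
    proof (rule quadratic_nonneg_imp_discriminant)
      fix t :: real
      have "m \<le> Q (\<lambda>x. 1 *\<^sub>R V k x + t *\<^sub>R w x) - 2 * (1 * R k + t * s)"
        using m_le [OF comb [OF VR [of k] w, of 1 t]] by (simp only: J_def fst_conv snd_conv)
      then show "0 \<le> 1 / real (Suc k) + 2 * t * (B (V k) w - s) + t\<^sup>2 * Q w"
        unfolding lin [OF w] using JVR [of k] by (simp add: algebra_simps)
    qed (rule Q0)
    then have "\<forall>\<^sub>F k in sequentially. (B (V k) w - s)\<^sup>2 \<le> 1 / real (Suc k) * Q w" by simp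
    moreover have "(\<lambda>k. 1 / real (Suc k) * Q w) \<longlonglongrightarrow> 0"
      using tendsto_mult_right [OF LIMSEQ_inverse_real_of_nat, of "Q w"] by (simp add: inverse_eq_divide)
    ultimately have "(\<lambda>k. (B (V k) w - s)\<^sup>2) \<longlonglongrightarrow> 0"
      by (rule tendsto_sandwich [OF _ _ tendsto_const, rotated]) simp
    then have "(\<lambda>k. B (V k) w - s) \<longlonglongrightarrow> 0" by simp
    then have "(\<lambda>k. B (V k) w) \<longlonglongrightarrow> s" by (simp add: LIM_zero_iff)
    with Blim [OF meas [OF w] int [OF w]] show ?thesis by (rule LIMSEQ_unique)
  qed
  have com: "B v w = B w v" for v w by (simp add: B_def inner_commute)
  have Bgg: "B g g = Q g" by (simp add: B_def Q_def power2_norm_eq_inner)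
  have R: "R n = B (V n) g" for n using repr [OF VR] com by simp
  have Rlim: "R \<longlonglongrightarrow> Q g" using Blim [OF g gI] by (simp add: R [abs_def] Bgg)
  have "(\<lambda>n. Q (V n)) \<longlonglongrightarrow> Q g"
  proof -
    have "Q (V n) = 2 * R n - Q g + Q (\<lambda>x. V n x - g x)" for n
      using integral_norm_square_combination [OF VM g VI gI, of 1 n "-1"]
      by (simp add: R Q_def B_def)
    moreover have "(\<lambda>n. 2 * R n - Q g + Q (\<lambda>x. V n x - g x)) \<longlonglongrightarrow> 2 * Q g - Q g + 0"
      by (intro tendsto_intros Rlim Qlim)
    ultimately show ?thesis by simp
  qed
  \<comment> \<open>The limit \<open>g\<close> may lie outside the vectors of \<open>S\<close>, so
    the hypothesis \<open>bound\<close> reaches it only by passing to the limit along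
    \<open>V\<close>.\<close>
  then have "(\<lambda>n. C * Q (V n)) \<longlonglongrightarrow> C * Q g" by (rule tendsto_mult_left)
  moreover have "(\<lambda>n. (R n)\<^sup>2) \<longlonglongrightarrow> (Q g)\<^sup>2" by (rule tendsto_power [OF Rlim])
  moreover have "(R n)\<^sup>2 \<le> C * Q (V n)" for n using bound [OF VR] by (simp add: Q_def)
  ultimately have "(Q g)\<^sup>2 \<le> C * Q g" by (intro LIMSEQ_le) auto
  then have "Q g \<le> C"
    using Q0 [of g] \<open>0 \<le> C\<close> by (cases "Q g = 0") (auto simp: power2_eq_square)
  moreover have "(LINT x|M. v x \<bullet> g x) = r" if "(v, r) \<in> S" for v r
    using repr [OF that] com [of v g] by (simp add: B_def)
  ultimately show thesis
    using that [OF g gI] by (simp add: Q_def)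
qed

section \<open>Integration by parts\<close>

lemma DERIV_shift_direction:
  fixes g :: "'a::real_normed_vector \<Rightarrow> real"
  assumes "((\<lambda>s. g ((x + t *\<^sub>R v) + s *\<^sub>R v)) has_real_derivative d) (at 0)"
  shows "((\<lambda>s. g (x + s *\<^sub>R v)) has_real_derivative d) (at t)"
proof -
  have "((\<lambda>s. g (x + s *\<^sub>R v)) has_real_derivative d) (at (0 + t))"
    unfolding DERIV_shift using assms by (simp add: algebra_simps)
  then show ?thesis by simp
qed

lemma DERIV_partial:
  assumes "g differentiable (at x)"
  shows "((\<lambda>t. g (x + t *\<^sub>R axis i 1)) has_real_derivative partial i g x) (at 0)"
proof -
  have "(\<lambda>t. x + t *\<^sub>R axis i (1::real)) differentiable (at 0)"
    by (rule differentiableI_vector)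
      (auto intro!: derivative_eq_intros simp: has_vector_derivative_add_const)
  moreover have "g differentiable (at (x + 0 *\<^sub>R axis i (1::real)))" using assms by simp
  ultimately have "(g \<circ> (\<lambda>t. x + t *\<^sub>R axis i (1::real))) differentiable (at 0)"
    by (rule differentiable_chain_at)
  then show ?thesis
    unfolding partial_def DERIV_deriv_iff_real_differentiable by (simp add: comp_def)
qed

lemma partial_unique:
  assumes "((\<lambda>t. g (x + t *\<^sub>R axis i 1)) has_real_derivative d) (at 0)"
  shows "partial i g x = d"
  unfolding partial_def by (rule DERIV_imp_deriv [OF assms])

text \<open>Two applications of the mean value theorem: along \<open>axis i 1\<close> to an
  increment of \<open>g\<close>, then along \<open>axis j 1\<close> to
  \<open>partial i g\<close>.\<close>

lemma second_difference_partial: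
  fixes g :: "real ^ 'm \<Rightarrow> real"
  assumes g: "\<And>x. g differentiable (at x)" and gi: "\<And>x. partial i g differentiable (at x)"
    and "0 < h"
  obtains s t where "0 < s" "s < h" "0 < t" "t < h"
    and "g (x + h *\<^sub>R axis i 1 + h *\<^sub>R axis j 1) - g (x + h *\<^sub>R axis i 1)
          - g (x + h *\<^sub>R axis j 1) + g x
        = h\<^sup>2 * partial j (partial i g) (x + s *\<^sub>R axis i 1 + t *\<^sub>R axis j 1)"
proof -
  define u where "u = (axis i 1 :: real ^ 'm)"
  define v where "v = (axis j 1 :: real ^ 'm)"
  have gu: "((\<lambda>s. g (y + s *\<^sub>R u)) has_real_derivative partial i g (y + s *\<^sub>R u)) (at s)" for y s
    unfolding u_def by (rule DERIV_shift_direction) (rule DERIV_partial [OF g])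
  have gv: "((\<lambda>s. partial i g (y + s *\<^sub>R v)) has_real_derivative
      partial j (partial i g) (y + s *\<^sub>R v)) (at s)" for y s
    unfolding v_def by (rule DERIV_shift_direction) (rule DERIV_partial [OF gi])
  \<comment> \<open>The mixed second difference of \<open>g\<close> is the increment of
    \<open>G\<close> over the interval from 0 to \<open>h\<close>.\<close>
  define G where "G s = g ((x + h *\<^sub>R v) + s *\<^sub>R u) - g (x + s *\<^sub>R u)" for s
  have "DERIV G s :> partial i g ((x + h *\<^sub>R v) + s *\<^sub>R u) - partial i g (x + s *\<^sub>R u)" for s
    unfolding G_def by (rule DERIV_diff; rule gu)
  from MVT2 [OF \<open>0 < h\<close> this] obtain s where s: "0 < s" "s < h"
    and 1: "G h - G 0 = h * (partial i g ((x + h *\<^sub>R v) + s *\<^sub>R u) - partial i g (x + s *\<^sub>R u))"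
    by auto
  from MVT2 [OF \<open>0 < h\<close> gv, of "x + s *\<^sub>R u"] obtain t where t: "0 < t" "t < h"
    and 2: "partial i g ((x + s *\<^sub>R u) + h *\<^sub>R v) - partial i g ((x + s *\<^sub>R u) + 0 *\<^sub>R v)
      = (h - 0) * partial j (partial i g) ((x + s *\<^sub>R u) + t *\<^sub>R v)"
    by blast
  have "G h - G 0 = h\<^sup>2 * partial j (partial i g) (x + s *\<^sub>R u + t *\<^sub>R v)"
    unfolding 1 using 2 by (simp add: power2_eq_square add_ac)
  then show thesis
    using that [OF s t] unfolding G_def u_def v_def by (simp add: add_ac)
qed

text \<open>Schwarz's theorem: the second difference is symmetric in \<open>i\<close> and
  \<open>j\<close>, so both mixed derivatives agree at points tending to \<open>x\<close>, and
  continuity gives equality at \<open>x\<close>.\<close>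

lemma partial_commute:
  fixes g :: "real ^ 'm \<Rightarrow> real"
  assumes g: "\<And>x. g differentiable (at x)"
    and gi: "\<And>x. partial i g differentiable (at x)" and gj: "\<And>x. partial j g differentiable (at x)"
    and cij: "continuous_on UNIV (partial i (partial j g))"
    and cji: "continuous_on UNIV (partial j (partial i g))"
  shows "partial i (partial j g) x = partial j (partial i g) x"
proof -
  have "\<exists>s t s' t'. (0 < s \<and> s < inverse (real (Suc n))) \<and> (0 < t \<and> t < inverse (real (Suc n)))
      \<and> (0 < s' \<and> s' < inverse (real (Suc n))) \<and> (0 < t' \<and> t' < inverse (real (Suc n)))
      \<and> partial j (partial i g) (x + s *\<^sub>R axis i 1 + t *\<^sub>R axis j 1)
        = partial i (partial j g) (x + s' *\<^sub>R axis j 1 + t' *\<^sub>R axis i 1)" for n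
  proof -
    define h where "h = inverse (real (Suc n))"
    have "0 < h" by (simp add: h_def)
    obtain s t where 1: "0 < s" "s < h" "0 < t" "t < h"
      "g (x + h *\<^sub>R axis i 1 + h *\<^sub>R axis j 1) - g (x + h *\<^sub>R axis i 1)
          - g (x + h *\<^sub>R axis j 1) + g x
        = h\<^sup>2 * partial j (partial i g) (x + s *\<^sub>R axis i 1 + t *\<^sub>R axis j 1)"
      by (rule second_difference_partial [OF g gi \<open>0 < h\<close>])
    obtain s' t' where 2: "0 < s'" "s' < h" "0 < t'" "t' < h"
      "g (x + h *\<^sub>R axis j 1 + h *\<^sub>R axis i 1) - g (x + h *\<^sub>R axis j 1)
          - g (x + h *\<^sub>R axis i 1) + g x
        = h\<^sup>2 * partial i (partial j g) (x + s' *\<^sub>R axis j 1 + t' *\<^sub>R axis i 1)"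
      by (rule second_difference_partial [OF g gj \<open>0 < h\<close>])
    have "h\<^sup>2 * partial j (partial i g) (x + s *\<^sub>R axis i 1 + t *\<^sub>R axis j 1)
        = h\<^sup>2 * partial i (partial j g) (x + s' *\<^sub>R axis j 1 + t' *\<^sub>R axis i 1)"
      unfolding 1(5) [symmetric] 2(5) [symmetric] by (simp add: add_ac)
    then have "partial j (partial i g) (x + s *\<^sub>R axis i 1 + t *\<^sub>R axis j 1)
        = partial i (partial j g) (x + s' *\<^sub>R axis j 1 + t' *\<^sub>R axis i 1)"
      using \<open>0 < h\<close> by simp
    with 1(1-4) 2(1-4) show ?thesis
      unfolding h_def [symmetric]
      by (intro exI [of _ s] exI [of _ t] exI [of _ s'] exI [of _ t']) simp
  qed
  then obtain s t s' t' where
    s: "\<And>n. 0 < s n \<and> s n < inverse (real (Suc n))" and t: "\<And>n. 0 < t n \<and> t n < inverse (real (Suc n))"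
    and s': "\<And>n. 0 < s' n \<and> s' n < inverse (real (Suc n))"
    and t': "\<And>n. 0 < t' n \<and> t' n < inverse (real (Suc n))"
    and eq: "\<And>n. partial j (partial i g) (x + s n *\<^sub>R axis i 1 + t n *\<^sub>R axis j 1)
        = partial i (partial j g) (x + s' n *\<^sub>R axis j 1 + t' n *\<^sub>R axis i 1)"
    by metis
  have lim: "r \<longlonglongrightarrow> 0" if "\<And>n. 0 < r n \<and> r n < inverse (real (Suc n))" for r
    by (rule tendsto_sandwich [OF _ _ tendsto_const LIMSEQ_inverse_real_of_nat])
      (use that in \<open>auto intro!: always_eventually less_imp_le\<close>)
  have point: "(\<lambda>n. x + a n *\<^sub>R axis k 1 + b n *\<^sub>R axis l 1) \<longlonglongrightarrow> x"
    if "a \<longlonglongrightarrow> 0" "b \<longlonglongrightarrow> 0" for a b and k l :: 'm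
  proof -
    have "(\<lambda>n. x + a n *\<^sub>R axis k 1 + b n *\<^sub>R axis l 1) \<longlonglongrightarrow> x + 0 *\<^sub>R axis k 1 + 0 *\<^sub>R axis l 1"
      by (intro tendsto_intros that)
    then show ?thesis by simp
  qed
  have "(\<lambda>n. partial j (partial i g) (x + s n *\<^sub>R axis i 1 + t n *\<^sub>R axis j 1))
      \<longlonglongrightarrow> partial j (partial i g) x"
    by (rule continuous_on_tendsto_compose [OF cji point [OF lim [OF s] lim [OF t]]]) auto
  moreover have "(\<lambda>n. partial i (partial j g) (x + s' n *\<^sub>R axis j 1 + t' n *\<^sub>R axis i 1))
      \<longlonglongrightarrow> partial i (partial j g) x"
    by (rule continuous_on_tendsto_compose [OF cij point [OF lim [OF s'] lim [OF t']]]) auto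
  ultimately show ?thesis unfolding eq by (rule LIMSEQ_unique [symmetric])
qed

section \<open>Integrals of compactly supported functions and of their derivatives\<close>

text \<open>The open sets \<open>\<Omega>\<close> and \<open>- K\<close> cover the space, and
  \<open>k\<close> is continuous on each. It applies to products with a weight such as
  \<open>exp (\<phi> x)\<close>, which is controlled on \<open>\<Omega>\<close> only.\<close>

lemma continuous_on_UNIV_if_support:
  fixes k :: "'a::t2_space \<Rightarrow> 'b::{t2_space,zero}"
  assumes "open \<Omega>" "compact K" "K \<subseteq> \<Omega>" "continuous_on \<Omega> k" "\<And>x. x \<notin> K \<Longrightarrow> k x = 0"
  shows "continuous_on UNIV k"
proof -
  have "continuous_on (- K) k"
    by (subst continuous_on_cong [where g = "\<lambda>_. 0"]) (use assms in auto)
  then have "continuous_on (\<Omega> \<union> - K) k"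
    using assms by (intro continuous_on_open_Un) (auto intro: compact_imp_closed)
  moreover have "\<Omega> \<union> - K = UNIV" using assms by blast
  ultimately show ?thesis by simp
qed

lemma integrable_lborel_if_support:
  fixes k :: "'a::euclidean_space \<Rightarrow> 'b::{banach,second_countable_topology}"
  assumes "compact K" "continuous_on UNIV k" "\<And>x. x \<notin> K \<Longrightarrow> k x = 0"
  shows "integrable lborel k"
proof -
  have "integrable lborel (\<lambda>x. indicator K x *\<^sub>R k x)"
    using assms by (intro borel_integrable_compact) (auto intro: continuous_on_subset)
  moreover have "(\<lambda>x. indicator K x *\<^sub>R k x) = k"
    using assms(3) by (auto simp: indicator_def)
  ultimately show ?thesis by simp
qed

text \<open>Moves integrals from \<open>\<Omega>\<close> to the whole space, where translation
  invariance is available.\<close>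

lemma
  fixes k :: "'a::euclidean_space \<Rightarrow> 'b::euclidean_space"
  assumes "open \<Omega>" "compact K" "K \<subseteq> \<Omega>" "continuous_on \<Omega> k" "\<And>x. x \<notin> K \<Longrightarrow> k x = 0"
  shows integrable_lebesgue_on_if_support: "integrable (lebesgue_on \<Omega>) k"
    and integral_lebesgue_on_if_support: "(LINT x|lebesgue_on \<Omega>. k x) = (LINT x|lborel. k x)"
proof -
  have "continuous_on UNIV k" by (rule continuous_on_UNIV_if_support [OF assms])
  then have k: "integrable lborel k" by (rule integrable_lborel_if_support [OF assms(2) _ assms(5)])
  have "(\<lambda>x. indicator \<Omega> x *\<^sub>R k x) = k"
    using assms(3,5) by (auto simp: fun_eq_iff indicator_def)
  moreover have "\<Omega> \<inter> space lebesgue \<in> sets lebesgue" using \<open>open \<Omega>\<close> by simp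
  ultimately show "integrable (lebesgue_on \<Omega>) k" "(LINT x|lebesgue_on \<Omega>. k x) = (LINT x|lborel. k x)"
    using k by (simp_all add: integrable_restrict_space integral_restrict_space
        integrable_completion integral_completion)
qed

lemma lborel_integral_translation:
  fixes h :: "'a::euclidean_space \<Rightarrow> real"
  assumes "h \<in> borel_measurable borel"
  shows "(LINT x|lborel. h (x + c)) = (LINT x|lborel. h x)"
proof -
  have "(LINT x|lborel. h x) = (LINT x|distr lborel borel ((+) c). h x)"
    by (simp add: lborel_distr_plus)
  also have "\<dots> = (LINT x|lborel. h (c + x))"
    using assms by (subst integral_distr) auto
  finally show ?thesis by (simp add: add.commute)
qed

text \<open>Difference quotients of \<open>h\<close> have integral zero by translation invariance,
  and they converge to \<open>h'\<close> under a common integrable bound.\<close>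

lemma lborel_integral_directional_derivative:
  fixes h h' :: "'a::euclidean_space \<Rightarrow> real" and v :: 'a
  assumes der: "\<And>x. ((\<lambda>t. h (x + t *\<^sub>R v)) has_real_derivative h' x) (at 0)"
    and ch: "continuous_on UNIV h" and ch': "continuous_on UNIV h'"
    and K: "compact K" "\<And>x. x \<notin> K \<Longrightarrow> h x = 0" "\<And>x. x \<notin> K \<Longrightarrow> h' x = 0"
  shows "(LINT x|lborel. h' x) = 0"
proof -
  have hM[measurable]: "h \<in> borel_measurable borel"
    by (rule borel_measurable_continuous_onI [OF ch])
  have h'M[measurable]: "h' \<in> borel_measurable borel"
    by (rule borel_measurable_continuous_onI [OF ch'])
  obtain B where B: "\<And>x. \<bar>h' x\<bar> \<le> B"
  proof -
    have "bounded (h' ` K)"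
      using K(1) ch' by (intro compact_imp_bounded compact_continuous_image) (auto intro: continuous_on_subset)
    then obtain b where b: "\<forall>x\<in>K. \<bar>h' x\<bar> \<le> b" by (auto simp: bounded_iff)
    \<comment> \<open>The maximum with 0 covers the points off \<open>K\<close>, where
      \<open>h'\<close> vanishes.\<close>
    have "\<bar>h' x\<bar> \<le> max b 0" for x using b K(3) [of x] by (cases "x \<in> K") auto
    then show thesis by (rule that)
  qed
  define \<epsilon> where "\<epsilon> n = inverse (real (Suc n))" for n
  have \<epsilon>: "0 < \<epsilon> n" "\<epsilon> n \<le> 1" for n by (auto simp: \<epsilon>_def field_simps)
  \<comment> \<open>Sweeping \<open>K\<close> backwards along \<open>v\<close> gives one compact set
    outside which all difference quotients with step at most 1 vanish.\<close>
  define L where "L = (\<lambda>p. fst p - snd p *\<^sub>R v) ` (K \<times> {0..1::real})"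
  have L: "compact L"
    unfolding L_def using K(1)
    by (intro compact_continuous_image compact_Times continuous_intros) auto
  have memL: "x \<in> L" if "x + s *\<^sub>R v \<in> K" "0 \<le> s" "s \<le> 1" for x s
  proof -
    have "x = (\<lambda>p. fst p - snd p *\<^sub>R v) (x + s *\<^sub>R v, s)" by simp
    then show ?thesis unfolding L_def using that by (intro image_eqI) auto
  qed
  define w where "w n x = (h (x + \<epsilon> n *\<^sub>R v) - h x) / \<epsilon> n" for n x
  have "(\<lambda>n. LINT x|lborel. w n x) \<longlonglongrightarrow> (LINT x|lborel. h' x)"
  proof (rule integral_dominated_convergence [where w = "\<lambda>x. indicator L x *\<^sub>R B"])
    show "integrable lborel (\<lambda>x. indicator L x *\<^sub>R B)"
      by (rule borel_integrable_compact [OF L]) simp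
    show "h' \<in> borel_measurable lborel" by simp
    show "w n \<in> borel_measurable lborel" for n unfolding w_def by measurable
    show "AE x in lborel. (\<lambda>n. w n x) \<longlonglongrightarrow> h' x"
    proof (rule AE_I2)
      fix x
      have "(\<lambda>t. (h (x + (0 + t) *\<^sub>R v) - h (x + 0 *\<^sub>R v)) / t) \<midarrow>0\<rightarrow> h' x"
        using der [of x] unfolding DERIV_def .
      moreover have "filterlim \<epsilon> (at 0) sequentially"
        unfolding filterlim_at \<epsilon>_def using LIMSEQ_inverse_real_of_nat by auto
      ultimately have "(\<lambda>n. (h (x + (0 + \<epsilon> n) *\<^sub>R v) - h (x + 0 *\<^sub>R v)) / \<epsilon> n) \<longlonglongrightarrow> h' x"
        by (rule filterlim_compose)
      then show "(\<lambda>n. w n x) \<longlonglongrightarrow> h' x" by (simp add: w_def)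
    qed
    show "AE x in lborel. norm (w n x) \<le> indicator L x *\<^sub>R B" for n
    proof (rule AE_I2)
      fix x
      show "norm (w n x) \<le> indicator L x *\<^sub>R B"
      proof (cases "x \<in> L")
        case True
        \<comment> \<open>By the mean value theorem each quotient is a value of \<open>h'\<close>,
          hence bounded by \<open>B\<close>.\<close>
        have "DERIV (\<lambda>t. h (x + t *\<^sub>R v)) t :> h' (x + t *\<^sub>R v)" for t
          by (rule DERIV_shift_direction) (rule der)
        from MVT2 [OF \<epsilon>(1) [of n] this] obtain z where
          "h (x + \<epsilon> n *\<^sub>R v) - h (x + 0 *\<^sub>R v) = (\<epsilon> n - 0) * h' (x + z *\<^sub>R v)" by blast
        then have "w n x = h' (x + z *\<^sub>R v)" using \<epsilon>(1) [of n] by (simp add: w_def)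
        with True B show ?thesis by simp
      next
        case False
        then have "x + \<epsilon> n *\<^sub>R v \<notin> K" "x \<notin> K"
          using memL [of x "\<epsilon> n"] memL [of x 0] \<epsilon> [of n] by auto
        with False K(2) show ?thesis by (simp add: w_def)
      qed
    qed
  qed
  moreover have "(LINT x|lborel. w n x) = 0" for n
  proof -
    have i: "integrable lborel h" by (rule integrable_lborel_if_support [OF K(1) ch K(2)])
    have "continuous_on UNIV (\<lambda>x. h (x + \<epsilon> n *\<^sub>R v))"
      by (rule continuous_on_compose2 [OF ch]) (auto intro!: continuous_intros)
    then have i': "integrable lborel (\<lambda>x. h (x + \<epsilon> n *\<^sub>R v))"
    proof (rule integrable_lborel_if_support [OF L])
      fix x assume "x \<notin> L"
      then show "h (x + \<epsilon> n *\<^sub>R v) = 0" using memL [of x "\<epsilon> n"] \<epsilon> [of n] K(2) by auto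
    qed
    show ?thesis
      unfolding w_def using i i' lborel_integral_translation [OF hM, of "\<epsilon> n *\<^sub>R v"] by simp
  qed
  ultimately show ?thesis by (simp add: LIMSEQ_const_iff)
qed

text \<open>The form of integration by parts used below. The derivative is known on
  \<open>\<Omega>\<close> only; a point outside has a neighbourhood in the open set
  \<open>- K\<close>, where \<open>h\<close> is zero.\<close>

lemma integral_partial_eq_0:
  fixes h h' :: "real ^ 'm \<Rightarrow> real"
  assumes \<Omega>: "open \<Omega>" "compact K" "K \<subseteq> \<Omega>"
    and ch: "continuous_on \<Omega> h" and ch': "continuous_on \<Omega> h'"
    and K: "\<And>x. x \<notin> K \<Longrightarrow> h x = 0" "\<And>x. x \<notin> K \<Longrightarrow> h' x = 0"
    and der: "\<And>x. x \<in> \<Omega> \<Longrightarrow> ((\<lambda>t. h (x + t *\<^sub>R axis i 1)) has_real_derivative h' x) (at 0)"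
  shows "(LINT x|lebesgue_on \<Omega>. h' x) = 0"
proof -
  have "((\<lambda>t. h (x + t *\<^sub>R axis i 1)) has_real_derivative h' x) (at 0)" for x
  proof (cases "x \<in> \<Omega>")
    case False
    then have x: "x \<in> - K" using \<Omega> by auto
    have "((\<lambda>t. x + t *\<^sub>R axis i (1::real)) \<longlongrightarrow> x + 0 *\<^sub>R axis i 1) (at 0)"
      by (intro tendsto_intros)
    moreover have "open (- K)" using \<Omega> by (auto intro: compact_imp_closed)
    ultimately have "\<forall>\<^sub>F t in at 0. x + t *\<^sub>R axis i (1::real) \<in> - K"
      using x by (intro topological_tendstoD) auto
    then have ev: "\<forall>\<^sub>F t in at 0. h (x + t *\<^sub>R axis i 1) = 0"
      by eventually_elim (use K(1) in auto)
    then have ev: "\<forall>\<^sub>F t in nhds 0. h (x + t *\<^sub>R axis i 1) = 0"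
      unfolding eventually_nhds_conv_at using K(1) x by simp
    have "h' x = 0" using K(2) x by simp
    moreover have "((\<lambda>t::real. 0::real) has_real_derivative 0) (at 0)" by simp
    ultimately show ?thesis
      using DERIV_cong_ev [OF refl ev, of "h' x" "h' x"] by simp
  qed (rule der)
  then have "(LINT x|lborel. h' x) = 0"
    by (rule lborel_integral_directional_derivative [OF _ _ _ \<open>compact K\<close> K])
      (auto intro!: continuous_on_UNIV_if_support [OF \<Omega>] ch ch' K)
  then show ?thesis
    using integral_lebesgue_on_if_support [OF \<Omega> ch' K(2)] by simp
qed

section \<open>The operator on test functions\<close>

lemma cl_sign_square [simp]: "cl_sign A B * cl_sign A B = 1"
  by (simp add: cl_sign_def flip: power_mult_distrib)

lemma cl_mult_nth: "(a \<otimes>\<^sub>c b) $ C = (\<Sum>A\<in>UNIV. a $ A * b $ sym_diff A C * cl_sign A (sym_diff A C))"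
proof -
  have "(a \<otimes>\<^sub>c b) $ C = (\<Sum>A\<in>UNIV. \<Sum>B\<in>UNIV. a $ A * b $ B * cl_sign A B * (if sym_diff A B = C then 1 else 0))"
    by (simp add: cl_mult_def cl_basis_def axis_def eq_commute [of C])
  also have "\<dots> = (\<Sum>A\<in>UNIV. \<Sum>B\<in>UNIV. if B = sym_diff A C then a $ A * b $ B * cl_sign A B else 0)"
  proof (intro sum.cong refl)
    fix A B :: "'a set"
    have "sym_diff A B = C \<longleftrightarrow> B = sym_diff A C" by blast
    then show "a $ A * b $ B * cl_sign A B * (if sym_diff A B = C then 1 else 0)
        = (if B = sym_diff A C then a $ A * b $ B * cl_sign A B else 0)" by simp
  qed
  finally show ?thesis by simp
qed

lemma cl_basis_mult_nth: "(cl_basis A \<otimes>\<^sub>c b) $ C = b $ sym_diff A C * cl_sign A (sym_diff A C)"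
proof -
  have "(cl_basis A \<otimes>\<^sub>c b) $ C
      = (\<Sum>B\<in>UNIV. if B = A then b $ sym_diff B C * cl_sign B (sym_diff B C) else 0)"
    unfolding cl_mult_nth by (intro sum.cong) (auto simp: cl_basis_def axis_def)
  then show ?thesis by simp
qed

lemma cl_mult_basis_nth: "(a \<otimes>\<^sub>c cl_basis B) $ C = a $ sym_diff B C * cl_sign (sym_diff B C) B"
proof -
  have "(a \<otimes>\<^sub>c cl_basis B) $ C
      = (\<Sum>A\<in>UNIV. if A = sym_diff B C then a $ A * cl_sign A B else 0)"
    unfolding cl_mult_nth
  proof (intro sum.cong refl)
    fix A
    have "sym_diff A C = B \<longleftrightarrow> A = sym_diff B C" by blast
    then show "a $ A * cl_basis B $ sym_diff A C * cl_sign A (sym_diff A C)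
        = (if A = sym_diff B C then a $ A * cl_sign A B else 0)"
      by (auto simp: cl_basis_def axis_def)
  qed
  then show ?thesis by simp
qed

lemma cl_sign_singleton: "cl_sign {i} {i} = -1"
  by (simp add: cl_sign_prod)

text \<open>Reindexing by the involution that toggles \<open>i\<close> in \<open>C\<close> exchanges
  the two factors, and toggling \<open>i\<close> changes the sign by
  \<open>cl_sign {i} {i} = -1\<close>.\<close>

lemma inner_cl_mult_gen_skew:
  "(a \<otimes>\<^sub>c cl_gen (Some i)) \<bullet> b = - (a \<bullet> (b \<otimes>\<^sub>c cl_gen (Some i)))"
proof -
  have "(a \<otimes>\<^sub>c cl_basis {i}) \<bullet> b
      = (\<Sum>C\<in>UNIV. a $ sym_diff {i} C * cl_sign (sym_diff {i} C) {i} * b $ C)"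
    by (simp only: inner_vec_def cl_mult_basis_nth inner_real_def)
  also have "\<dots> = (\<Sum>C\<in>UNIV. a $ C * cl_sign C {i} * b $ sym_diff {i} C)"
  proof (rule sum.reindex_bij_witness [of _ "\<lambda>C. sym_diff {i} C" "\<lambda>C. sym_diff {i} C"])
    fix C
    have "sym_diff {i} (sym_diff {i} C) = C" by blast
    then show "sym_diff {i} (sym_diff {i} C) = C"
      and "a $ sym_diff {i} C * cl_sign (sym_diff {i} C) {i} * b $ sym_diff {i} (sym_diff {i} C)
        = a $ sym_diff {i} C * cl_sign (sym_diff {i} C) {i} * b $ C"
      by simp_all
  qed blast+
  also have "\<dots> = (\<Sum>C\<in>UNIV. - (a $ C * (b $ sym_diff {i} C * cl_sign (sym_diff {i} C) {i})))"
    by (intro sum.cong refl) (simp only: cl_sign_sym_diff_left cl_sign_singleton, simp)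
  also have "\<dots> = - (a \<bullet> (b \<otimes>\<^sub>c cl_basis {i}))"
    by (simp only: inner_vec_def cl_mult_basis_nth inner_real_def sum_negf)
  finally show ?thesis by (simp add: cl_gen_def)
qed

text \<open>This is Clifford conjugation: for \<open>A\<close> with \<open>r\<close> elements
  \<open>cl_sign A A\<close> is -1 to the power \<open>r * (r + 1) / 2\<close>. It expresses the
  scalar part of a product as a Euclidean inner product.\<close>

definition cl_twist :: "'n::{finite,linorder} clifford \<Rightarrow> 'n clifford" where
  "cl_twist a = (\<chi> A. cl_sign A A * a $ A)"

lemma norm_cl_twist [simp]: "norm (cl_twist a) = norm a"
proof -
  have "(cl_sign A A * a $ A)\<^sup>2 = (a $ A)\<^sup>2" for A
    using cl_sign_square [of A A] by (simp add: power_mult_distrib power2_eq_square)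
  then show ?thesis by (simp add: norm_vec_def L2_set_def cl_twist_def)
qed

lemma linear_cl_twist: "linear cl_twist"
  by (rule linearI) (simp_all add: cl_twist_def vec_eq_iff algebra_simps)

lemma cl_mult_scalar_part: "(a \<otimes>\<^sub>c b) $ {} = cl_twist a \<bullet> b"
  by (simp add: cl_mult_nth cl_twist_def inner_vec_def mult_ac)

text \<open>Left multiplication by a basis element moves any coordinate of a product to its scalar part.\<close>

lemma cl_mult_nth_eq_inner:
  "(a \<otimes>\<^sub>c b) $ C = cl_sign C C * (cl_twist (cl_basis C \<otimes>\<^sub>c a) \<bullet> b)"
proof -
  have "cl_twist (cl_basis C \<otimes>\<^sub>c a) \<bullet> b = cl_sign C C * (a \<otimes>\<^sub>c b) $ C"
    by (simp add: cl_mult_assoc cl_basis_mult_nth mult.commute flip: cl_mult_scalar_part)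
  then show ?thesis by (simp flip: mult.assoc)
qed

lemma cl_norm_square: "(cl_norm a)\<^sup>2 = 2 ^ CARD('n) * (norm a)\<^sup>2"
  for a :: "'n::{finite,linorder} clifford"
  by (simp add: cl_norm_def norm_vec_def L2_set_def sum_nonneg)

lemma bounded_linear_cl_mult_left: "bounded_linear (\<lambda>a. a \<otimes>\<^sub>c b)"
  using bilinear_cl_mult by (auto simp: bilinear_def linear_conv_bounded_linear)

lemma bounded_linear_cl_mult_right: "bounded_linear (\<lambda>b. a \<otimes>\<^sub>c b)"
  using bilinear_cl_mult by (auto simp: bilinear_def linear_conv_bounded_linear)

lemma bounded_linear_cl_twist: "bounded_linear cl_twist"
  using linear_cl_twist by (simp add: linear_conv_bounded_linear)

section \<open>Smooth Clifford-valued functions and the operator acting from the right\<close>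

lemma C_on_linear_combination:
  assumes "C_on k UNIV g" "C_on k UNIV h"
  shows "C_on k UNIV (\<lambda>x. a * g x + b * h x)"
  using assms
proof (induction k arbitrary: g h)
  case 0
  then show ?case by (auto intro!: continuous_intros)
next
  case (Suc k)
  then have d: "g differentiable (at x)" "h differentiable (at x)" for x
    by (auto simp: differentiable_on_def)
  have "partial i (\<lambda>x. a * g x + b * h x) = (\<lambda>x. a * partial i g x + b * partial i h x)" for i
  proof
    fix x
    show "partial i (\<lambda>x. a * g x + b * h x) x = a * partial i g x + b * partial i h x"
      by (rule partial_unique)
        (use DERIV_partial [OF d(1)] DERIV_partial [OF d(2)] in \<open>auto intro!: derivative_eq_intros\<close>)
  qed
  with Suc show ?case by (auto intro!: differentiable_on_add differentiable_on_mult)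
qed

lemma C_on_zero: "C_on k UNIV (\<lambda>x. 0)"
proof (induction k)
  case (Suc k)
  have "partial i (\<lambda>x. 0) = (\<lambda>x. 0)" for i :: 'a
    by (intro ext partial_unique) simp
  with Suc show ?case by simp
qed simp

definition smooth :: "(real ^ 'm \<Rightarrow> real ^ 'k) \<Rightarrow> bool" where
  "smooth \<alpha> \<longleftrightarrow> (\<forall>A k. C_on k UNIV (\<lambda>x. \<alpha> x $ A))"

text \<open>Keeping the value a vector lets the rules for vector derivatives, bounded linear maps
  and inner products replace computations in coordinates.\<close>

definition vpartial :: "'m \<Rightarrow> (real ^ 'm \<Rightarrow> real ^ 'k) \<Rightarrow> real ^ 'm \<Rightarrow> real ^ 'k" where
  "vpartial i \<alpha> x = (\<chi> A. partial i (\<lambda>y. \<alpha> y $ A) x)"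

lemma smooth_differentiable: "smooth \<alpha> \<Longrightarrow> (\<lambda>x. \<alpha> x $ A) differentiable (at x)"
proof -
  assume "smooth \<alpha>"
  then have "C_on (Suc 0) UNIV (\<lambda>x. \<alpha> x $ A)"
    unfolding smooth_def by blast
  then show ?thesis by (simp add: differentiable_on_def)
qed

lemma smooth_continuous: "smooth \<alpha> \<Longrightarrow> continuous_on S \<alpha>"
proof -
  assume "smooth \<alpha>"
  then have "C_on 0 UNIV (\<lambda>x. \<alpha> x $ A)" for A
    unfolding smooth_def by blast
  then have "continuous_on UNIV (\<lambda>x. \<alpha> x $ A)" for A by simp
  then have "continuous_on UNIV (\<lambda>x. \<chi> A. \<alpha> x $ A)" by (rule continuous_on_vec_lambda)
  then show ?thesis by (auto intro: continuous_on_subset)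
qed

lemma smooth_vpartial: "smooth \<alpha> \<Longrightarrow> smooth (vpartial i \<alpha>)"
  unfolding smooth_def
proof (intro allI)
  fix A k assume "\<forall>A k. C_on k UNIV (\<lambda>x. \<alpha> x $ A)"
  then have "C_on (Suc k) UNIV (\<lambda>x. \<alpha> x $ A)" by blast
  then show "C_on k UNIV (\<lambda>x. vpartial i \<alpha> x $ A)" by (simp add: vpartial_def)
qed

lemma vpartial_has_vector_derivative:
  assumes "smooth \<alpha>"
  shows "((\<lambda>t. \<alpha> (x + t *\<^sub>R axis i 1)) has_vector_derivative vpartial i \<alpha> x) (at 0)"
proof -
  have "((\<lambda>t. \<alpha> (x + t *\<^sub>R axis i 1) $ A) has_vector_derivative vpartial i \<alpha> x $ A) (at 0)" for A
    using DERIV_partial [OF smooth_differentiable [OF assms, of A x], of i]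
    by (simp add: vpartial_def has_real_derivative_iff_has_vector_derivative)
  then show ?thesis
    unfolding has_vector_derivative_def
    by (subst has_derivative_componentwise_within) (auto simp: Basis_vec_def inner_axis)
qed

lemma vpartial_eqI:
  assumes "((\<lambda>t. \<alpha> (x + t *\<^sub>R axis i 1)) has_vector_derivative d) (at 0)"
  shows "vpartial i \<alpha> x = d"
proof -
  have "partial i (\<lambda>y. \<alpha> y $ A) x = d $ A" for A
    by (rule partial_unique)
      (use bounded_linear.has_vector_derivative [OF bounded_linear_vec_nth assms, of A]
        in \<open>simp add: has_real_derivative_iff_has_vector_derivative\<close>)
  then show ?thesis by (simp add: vpartial_def vec_eq_iff)
qed

lemma vpartial_commute:
  assumes "smooth \<alpha>"
  shows "vpartial i (vpartial j \<alpha>) x = vpartial j (vpartial i \<alpha>) x"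
proof -
  have s: "smooth (vpartial i \<alpha>)" for i by (rule smooth_vpartial [OF assms])
  have eq: "(\<lambda>y. vpartial i \<alpha> y $ A) = partial i (\<lambda>y. \<alpha> y $ A)" for i A
    by (simp add: vpartial_def)
  have "continuous_on UNIV (\<lambda>x. vpartial i (vpartial j \<alpha>) x $ A)" for i j A
    by (intro continuous_intros smooth_continuous smooth_vpartial s)
  then have c: "continuous_on UNIV (partial i (partial j (\<lambda>y. \<alpha> y $ A)))" for i j A
    by (simp add: vpartial_def)
  have "partial i (\<lambda>y. \<alpha> y $ A) differentiable (at x)" for i A x
    using smooth_differentiable [OF s, of i A x] by (simp add: eq)
  then have "partial i (partial j (\<lambda>y. \<alpha> y $ A)) x = partial j (partial i (\<lambda>y. \<alpha> y $ A)) x" for A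
    by (intro partial_commute smooth_differentiable assms c)
  then show ?thesis by (simp add: vpartial_def)
qed

lemma vpartial_eq_0_outside:
  assumes "compact K" "\<And>x. x \<notin> K \<Longrightarrow> \<alpha> x = 0" "x \<notin> K"
  shows "vpartial i \<alpha> x = 0"
proof (rule vpartial_eqI)
  have "((\<lambda>t. x + t *\<^sub>R axis i (1::real)) \<longlongrightarrow> x + 0 *\<^sub>R axis i 1) (nhds 0)"
    by (intro tendsto_intros filterlim_ident)
  moreover have "open (- K)" using assms by (auto intro: compact_imp_closed)
  ultimately have "\<forall>\<^sub>F t in nhds 0. x + t *\<^sub>R axis i (1::real) \<in> - K"
    using assms by (intro topological_tendstoD) auto
  then have ev: "\<forall>\<^sub>F t in nhds 0. \<alpha> (x + t *\<^sub>R axis i 1) = 0"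
    by eventually_elim (use assms in auto)
  show "((\<lambda>t. \<alpha> (x + t *\<^sub>R axis i 1)) has_vector_derivative 0) (at 0)"
    by (subst has_vector_derivative_cong_ev [where g = "\<lambda>_. 0"])
      (use ev assms in \<open>auto elim: eventually_mono intro!: derivative_eq_intros\<close>)
qed

lemma Dbar_right_eq: "Dbar_right \<alpha> x = (\<Sum>i\<in>UNIV. vpartial i \<alpha> x \<otimes>\<^sub>c cl_gen i)"
proof -
  have "vpartial i \<alpha> x \<otimes>\<^sub>c cl_gen i
      = (\<Sum>A\<in>UNIV. partial i (\<lambda>y. \<alpha> y $ A) x *\<^sub>R (cl_basis A \<otimes>\<^sub>c cl_gen i))" for i
    by (subst cl_expand [of "vpartial i \<alpha> x"])
      (simp only: cl_mult_sum_left cl_mult_scaleR_left vpartial_def vec_lambda_beta)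
  then show ?thesis by (simp add: Dbar_right_def)
qed

text \<open>Separates the unit \<open>e_0\<close>, whose derivative is skew under integration, from
  the generators, whose skew multiplication makes the remaining sum symmetric.\<close>

lemma Dbar_right_split:
  "Dbar_right \<alpha> x = vpartial None \<alpha> x + (\<Sum>j\<in>UNIV. vpartial (Some j) \<alpha> x \<otimes>\<^sub>c cl_gen (Some j))"
  unfolding Dbar_right_eq UNIV_option_conv
  by (subst sum.insert) (auto simp: sum.reindex cl_mult_one_right)

lemma continuous_on_Dbar_right: "smooth \<alpha> \<Longrightarrow> continuous_on S (Dbar_right \<alpha>)"
  unfolding Dbar_right_eq [abs_def]
  by (intro continuous_intros bounded_linear.continuous_on [OF bounded_linear_cl_mult_left]
      smooth_continuous smooth_vpartial)

lemma Dbar_right_eq_0_outside: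
  assumes "compact K" "\<And>x. x \<notin> K \<Longrightarrow> \<alpha> x = 0" "x \<notin> K"
  shows "Dbar_right \<alpha> x = 0"
  by (simp add: Dbar_right_eq vpartial_eq_0_outside [OF assms] bilinear_lzero [OF bilinear_cl_mult])

text \<open>The coordinates are finitely many, so their supports have a compact union, and a single
  \<open>K\<close> serves all of them.\<close>

lemma test_functions_iff:
  "\<alpha> \<in> test_functions \<Omega> \<longleftrightarrow> smooth \<alpha> \<and> (\<exists>K. compact K \<and> K \<subseteq> \<Omega> \<and> (\<forall>x. x \<notin> K \<longrightarrow> \<alpha> x = 0))"
proof
  assume \<alpha>: "\<alpha> \<in> test_functions \<Omega>"
  define K where "K = (\<Union>A. closure {x. \<alpha> x $ A \<noteq> 0})"
  have "compact K" using \<alpha> unfolding K_def test_functions_def by (intro compact_UN) auto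
  moreover have "K \<subseteq> \<Omega>" using \<alpha> unfolding K_def test_functions_def by blast
  moreover have "\<alpha> x = 0" if "x \<notin> K" for x
  proof -
    have "\<alpha> x $ A = 0" for A
      using that closure_subset [of "{x. \<alpha> x $ A \<noteq> 0}"] unfolding K_def by auto
    then show ?thesis by (simp add: vec_eq_iff)
  qed
  ultimately show "smooth \<alpha> \<and> (\<exists>K. compact K \<and> K \<subseteq> \<Omega> \<and> (\<forall>x. x \<notin> K \<longrightarrow> \<alpha> x = 0))"
    using \<alpha> by (auto simp: smooth_def test_functions_def)
next
  assume "smooth \<alpha> \<and> (\<exists>K. compact K \<and> K \<subseteq> \<Omega> \<and> (\<forall>x. x \<notin> K \<longrightarrow> \<alpha> x = 0))"
  then obtain K where "smooth \<alpha>" and K: "compact K" "K \<subseteq> \<Omega>" "\<And>x. x \<notin> K \<Longrightarrow> \<alpha> x = 0" by blast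
  have sub: "closure {x. \<alpha> x $ A \<noteq> 0} \<subseteq> K" for A
  proof (rule closure_minimal)
    show "{x. \<alpha> x $ A \<noteq> 0} \<subseteq> K" using K(3) by (metis (mono_tags, lifting) mem_Collect_eq subsetI zero_index)
  qed (rule compact_imp_closed [OF K(1)])
  then have "compact (closure {x. \<alpha> x $ A \<noteq> 0})" for A
    using compact_Int_closed [OF K(1) closed_closure, of "{x. \<alpha> x $ A \<noteq> 0}"] by (simp add: inf.absorb2)
  then show "\<alpha> \<in> test_functions \<Omega>"
    using sub K(2) \<open>smooth \<alpha>\<close> unfolding test_functions_def smooth_def by blast
qed

lemma smooth_linear_combination:
  assumes "smooth \<alpha>" "smooth \<beta>"
  shows "smooth (\<lambda>x. a *\<^sub>R \<alpha> x + b *\<^sub>R \<beta> x)"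
  using assms by (auto simp: smooth_def intro: C_on_linear_combination)

lemma test_functions_linear_combination:
  assumes "\<alpha> \<in> test_functions \<Omega>" "\<beta> \<in> test_functions \<Omega>"
  shows "(\<lambda>x. a *\<^sub>R \<alpha> x + b *\<^sub>R \<beta> x) \<in> test_functions \<Omega>"
proof -
  obtain K L where "compact K" "K \<subseteq> \<Omega>" "\<And>x. x \<notin> K \<Longrightarrow> \<alpha> x = 0"
    "compact L" "L \<subseteq> \<Omega>" "\<And>x. x \<notin> L \<Longrightarrow> \<beta> x = 0" and s: "smooth \<alpha>" "smooth \<beta>"
    using assms unfolding test_functions_iff by blast
  then have "compact (K \<union> L) \<and> K \<union> L \<subseteq> \<Omega> \<and> (\<forall>x. x \<notin> K \<union> L \<longrightarrow> a *\<^sub>R \<alpha> x + b *\<^sub>R \<beta> x = 0)"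
    by auto
  with smooth_linear_combination [OF s] show ?thesis
    unfolding test_functions_iff by blast
qed

lemma Dbar_right_linear_combination:
  assumes "smooth \<alpha>" "smooth \<beta>"
  shows "Dbar_right (\<lambda>x. a *\<^sub>R \<alpha> x + b *\<^sub>R \<beta> x) x = a *\<^sub>R Dbar_right \<alpha> x + b *\<^sub>R Dbar_right \<beta> x"
proof -
  have "vpartial i (\<lambda>x. a *\<^sub>R \<alpha> x + b *\<^sub>R \<beta> x) x = a *\<^sub>R vpartial i \<alpha> x + b *\<^sub>R vpartial i \<beta> x" for i
    by (rule vpartial_eqI)
      (intro has_vector_derivative_add bounded_linear.has_vector_derivative [OF bounded_linear_scaleR_right]
        vpartial_has_vector_derivative assms)
  then show ?thesis
    by (simp add: Dbar_right_eq bilinear_ladd [OF bilinear_cl_mult]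
        cl_mult_scaleR_left sum.distrib scaleR_right.sum)
qed

lemma test_functions_cl_basis_mult:
  assumes "\<alpha> \<in> test_functions \<Omega>"
  shows "(\<lambda>x. cl_basis C \<otimes>\<^sub>c \<alpha> x) \<in> test_functions \<Omega>"
proof -
  obtain K where K: "compact K" "K \<subseteq> \<Omega>" "\<And>x. x \<notin> K \<Longrightarrow> \<alpha> x = 0" and s: "smooth \<alpha>"
    using assms unfolding test_functions_iff by blast
  have "C_on k UNIV (\<lambda>x. (cl_basis C \<otimes>\<^sub>c \<alpha> x) $ A)" for k A
  proof -
    have 1: "C_on k UNIV (\<lambda>x. \<alpha> x $ sym_diff C A)" using s by (simp add: smooth_def)
    show ?thesis
      \<comment> \<open>A coordinate of the product is plus or minus one coordinate of
        \<open>\<alpha>\<close>, written as a combination with second coefficient 0.\<close>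
      using C_on_linear_combination [OF 1 1, of "cl_sign C (sym_diff C A)" 0]
      by (simp add: cl_basis_mult_nth mult.commute)
  qed
  then have "smooth (\<lambda>x. cl_basis C \<otimes>\<^sub>c \<alpha> x)" by (simp add: smooth_def)
  with K show ?thesis
    unfolding test_functions_iff
    by (auto intro!: exI [of _ K] simp: bilinear_rzero [OF bilinear_cl_mult])
qed

text \<open>Constants on the left commute with an operator acting from the right, by associativity.
  This is how the scalar part of the weak equation yields the other coordinates.\<close>

lemma Dbar_right_cl_basis_mult:
  assumes "smooth \<alpha>"
  shows "Dbar_right (\<lambda>x. cl_basis C \<otimes>\<^sub>c \<alpha> x) x = cl_basis C \<otimes>\<^sub>c Dbar_right \<alpha> x"
proof -
  have "vpartial i (\<lambda>x. cl_basis C \<otimes>\<^sub>c \<alpha> x) x = cl_basis C \<otimes>\<^sub>c vpartial i \<alpha> x" for i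
    by (rule vpartial_eqI)
      (intro bounded_linear.has_vector_derivative [OF bounded_linear_cl_mult_right]
        vpartial_has_vector_derivative assms)
  then show ?thesis by (simp add: Dbar_right_eq cl_mult_sum_right cl_mult_assoc)
qed

section \<open>The weighted estimate and existence\<close>

lemma DERIV_inner:
  fixes f g :: "real \<Rightarrow> 'a::real_inner"
  assumes "(f has_vector_derivative f') (at t)" "(g has_vector_derivative g') (at t)"
  shows "((\<lambda>t. f t \<bullet> g t) has_real_derivative (f t \<bullet> g' + f' \<bullet> g t)) (at t)"
  unfolding has_real_derivative_iff_has_vector_derivative
  by (rule bounded_bilinear.has_vector_derivative [OF bounded_bilinear_inner assms])

text \<open>
  Used with \<open>a = \<alpha>\<close>, \<open>b = \<partial>\<^sub>0\<alpha>\<close>, \<open>c = P\<alpha>\<close>, \<open>p = \<phi>'\<close>, \<open>q = \<phi>''\<close>: after multiplication by \<open>e\<^sup>\<phi>\<close> the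
  two groups not consisting of squares become sums of divergences and integrate to zero.
\<close>

lemma energy_identity:
  fixes a b c :: "'a::real_inner" and p q :: real
  shows "(norm (b + c))\<^sup>2 - q * (norm a)\<^sup>2 / 2
    = (norm (b + (p / 2) *\<^sub>R a))\<^sup>2 + (norm (c - (p / 2) *\<^sub>R a))\<^sup>2
      - (p\<^sup>2 * (a \<bullet> a) + q * (a \<bullet> a) + 2 * p * (a \<bullet> b)) / 2 + (p * (a \<bullet> c) + 2 * (b \<bullet> c))"
  unfolding power2_norm_eq_inner
  by (simp add: inner_add_left inner_add_right inner_diff_left inner_diff_right inner_commute
      power2_eq_square field_simps)

text \<open>\<open>energy_identity\<close> is multiplied by \<open>exp (\<phi> x)\<close> and
  integrated: the terms that are not squares integrate to zero and the squares are nonnegative. Here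
  \<open>p\<close> and \<open>q\<close> stand for the first and second derivative of
  \<open>\<phi>\<close> in \<open>x_0\<close>.\<close>

lemma Dbar_right_energy:
  fixes \<Omega> :: "(real ^ ('n::{finite,linorder}) option) set"
    and \<alpha> :: "real ^ 'n option \<Rightarrow> 'n clifford"
  assumes "open \<Omega>" and \<alpha>: "\<alpha> \<in> test_functions \<Omega>"
    and \<phi>0: "\<And>x. x \<in> \<Omega> \<Longrightarrow>
      ((\<lambda>t. \<phi> (x + t *\<^sub>R axis None 1)) has_real_derivative p x) (at 0)"
    and \<phi>j: "\<And>x j. x \<in> \<Omega> \<Longrightarrow>
      ((\<lambda>t. \<phi> (x + t *\<^sub>R axis (Some j) 1)) has_real_derivative 0) (at 0)"
    and p0: "\<And>x. x \<in> \<Omega> \<Longrightarrow>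
      ((\<lambda>t. p (x + t *\<^sub>R axis None 1)) has_real_derivative q x) (at 0)"
    and c\<phi>: "continuous_on \<Omega> \<phi>" and cp: "continuous_on \<Omega> p" and cq: "continuous_on \<Omega> q"
  shows "(LINT x|lebesgue_on \<Omega>. exp (\<phi> x) * (q x * (norm (\<alpha> x))\<^sup>2))
    \<le> 2 * (LINT x|lebesgue_on \<Omega>. exp (\<phi> x) * (norm (Dbar_right \<alpha> x))\<^sup>2)"
proof -
  obtain K where K: "compact K" "K \<subseteq> \<Omega>" "\<And>x. x \<notin> K \<Longrightarrow> \<alpha> x = 0" and s: "smooth \<alpha>"
    using \<alpha> unfolding test_functions_iff by blast
  note \<Omega>K = \<open>open \<Omega>\<close> K(1,2)
  define R where "R j a = a \<otimes>\<^sub>c cl_gen (Some j)" for j :: 'n and a :: "'n clifford"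
  have blR: "bounded_linear (R j)" for j
    unfolding R_def [abs_def] by (rule bounded_linear_cl_mult_left)
  have R0 [simp]: "R j 0 = 0" for j
    by (simp add: R_def bilinear_lzero [OF bilinear_cl_mult])
  define d0 where "d0 = vpartial None \<alpha>"
  define d where "d j = vpartial (Some j) \<alpha>" for j
  define P where "P x = (\<Sum>j\<in>UNIV. R j (d j x))" for x
  have D: "Dbar_right \<alpha> x = d0 x + P x" for x
    by (simp add: Dbar_right_split d0_def d_def P_def R_def)
  have sd0: "smooth d0" and sd: "smooth (d j)" for j
    unfolding d0_def d_def by (intro smooth_vpartial s)+
  have commute: "vpartial None (d j) x = vpartial (Some j) d0 x" for j x
    unfolding d0_def d_def by (rule vpartial_commute [OF s])
  have d0z: "d0 x = 0" and dz: "d j x = 0" if "x \<notin> K" for x j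
    unfolding d0_def d_def by (rule vpartial_eq_0_outside [OF K(1,3) that]; assumption)+
  note cont = continuous_on_mult continuous_on_exp continuous_on_inner continuous_on_add
    continuous_on_diff continuous_on_power continuous_on_norm continuous_on_const continuous_on_scaleR
    continuous_on_sum continuous_on_divide bounded_linear.continuous_on [OF blR] c\<phi> cp cq
    smooth_continuous [OF s] smooth_continuous [OF sd0] smooth_continuous [OF sd]
    smooth_continuous [OF smooth_vpartial [OF sd0]] smooth_continuous [OF smooth_vpartial [OF sd]]
  \<comment> \<open>Its derivative in \<open>x_0\<close> produces the term with \<open>q\<close>,
    the source of the second derivative of the weight.\<close>
  define h1 where "h1 x = exp (\<phi> x) * (p x * (\<alpha> x \<bullet> \<alpha> x))" for x
  define h1' where "h1' x = exp (\<phi> x) *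
    ((p x)\<^sup>2 * (\<alpha> x \<bullet> \<alpha> x) + q x * (\<alpha> x \<bullet> \<alpha> x) + 2 * p x * (\<alpha> x \<bullet> d0 x))" for x
  have int1: "integrable (lebesgue_on \<Omega>) h1'"
    unfolding h1'_def [abs_def]
    by (rule integrable_lebesgue_on_if_support [OF \<Omega>K]) (auto simp: K intro!: cont)
  have 1: "(LINT x|lebesgue_on \<Omega>. h1' x) = 0"
  proof (rule integral_partial_eq_0 [OF \<Omega>K, where h = h1 and i = None])
    show "continuous_on \<Omega> h1" unfolding h1_def [abs_def] by (intro cont)
    show "continuous_on \<Omega> h1'" unfolding h1'_def [abs_def] by (intro cont)
    show "h1 x = 0" "h1' x = 0" if "x \<notin> K" for x using K that by (auto simp: h1_def h1'_def)
    fix x assume "x \<in> \<Omega>"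
    note ders = \<phi>0 [OF this] p0 [OF this]
      DERIV_inner [OF vpartial_has_vector_derivative [OF s] vpartial_has_vector_derivative [OF s],
        of x None]
    show "((\<lambda>t. h1 (x + t *\<^sub>R axis None 1)) has_real_derivative h1' x) (at 0)"
      unfolding h1_def
      by (rule DERIV_cong, (rule derivative_intros ders)+)
        (simp add: h1'_def d0_def power2_eq_square algebra_simps inner_commute)
  qed
  \<comment> \<open>Differentiated in \<open>x_0\<close>, this pairs with \<open>h3\<close>, where
    the two derivatives are taken in the opposite order.\<close>
  define h2 where "h2 j x = exp (\<phi> x) * (\<alpha> x \<bullet> R j (d j x))" for j x
  define h2' where "h2' j x = exp (\<phi> x) * (p x * (\<alpha> x \<bullet> R j (d j x)) + d0 x \<bullet> R j (d j x)
    + \<alpha> x \<bullet> R j (vpartial None (d j) x))" for j x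
  have int2: "integrable (lebesgue_on \<Omega>) (h2' j)" for j
    unfolding h2'_def [abs_def]
    by (rule integrable_lebesgue_on_if_support [OF \<Omega>K]) (auto simp: K dz intro!: cont)
  have 2: "(LINT x|lebesgue_on \<Omega>. h2' j x) = 0" for j
  proof (rule integral_partial_eq_0 [OF \<Omega>K, where h = "h2 j" and i = None])
    show "continuous_on \<Omega> (h2 j)" unfolding h2_def [abs_def] by (intro cont)
    show "continuous_on \<Omega> (h2' j)" unfolding h2'_def [abs_def] by (intro cont)
    show "h2 j x = 0" "h2' j x = 0" if "x \<notin> K" for x using K dz that by (auto simp: h2_def h2'_def)
    fix x assume "x \<in> \<Omega>"
    note ders = \<phi>0 [OF this]
      DERIV_inner [OF vpartial_has_vector_derivative [OF s]
        bounded_linear.has_vector_derivative [OF blR vpartial_has_vector_derivative [OF sd]],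
        of x None j j]
    show "((\<lambda>t. h2 j (x + t *\<^sub>R axis None 1)) has_real_derivative h2' j x) (at 0)"
      unfolding h2_def
      by (rule DERIV_cong, (rule derivative_intros ders)+)
        (simp add: h2'_def d0_def algebra_simps)
  qed
  \<comment> \<open>Differentiated in direction \<open>Some j\<close>, along which the weight is
    constant, so no derivative of \<open>\<phi>\<close> appears in \<open>h3'\<close>.\<close>
  define h3 where "h3 j x = exp (\<phi> x) * (\<alpha> x \<bullet> R j (d0 x))" for j x
  define h3' where "h3' j x = exp (\<phi> x) * (d j x \<bullet> R j (d0 x)
    + \<alpha> x \<bullet> R j (vpartial (Some j) d0 x))" for j x
  have int3: "integrable (lebesgue_on \<Omega>) (h3' j)" for j
    unfolding h3'_def [abs_def]
    by (rule integrable_lebesgue_on_if_support [OF \<Omega>K]) (auto simp: K dz intro!: cont)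
  have 3: "(LINT x|lebesgue_on \<Omega>. h3' j x) = 0" for j
  proof (rule integral_partial_eq_0 [OF \<Omega>K, where h = "h3 j" and i = "Some j"])
    show "continuous_on \<Omega> (h3 j)" unfolding h3_def [abs_def] by (intro cont)
    show "continuous_on \<Omega> (h3' j)" unfolding h3'_def [abs_def] by (intro cont)
    show "h3 j x = 0" "h3' j x = 0" if "x \<notin> K" for x using K dz that by (auto simp: h3_def h3'_def)
    fix x assume "x \<in> \<Omega>"
    note ders = \<phi>j [OF this, of j]
      DERIV_inner [OF vpartial_has_vector_derivative [OF s]
        bounded_linear.has_vector_derivative [OF blR vpartial_has_vector_derivative [OF sd0]],
        of x "Some j" j]
    show "((\<lambda>t. h3 j (x + t *\<^sub>R axis (Some j) 1)) has_real_derivative h3' j x) (at 0)"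
      unfolding h3_def
      by (rule DERIV_cong, (rule derivative_intros ders)+)
        (simp add: h3'_def d_def algebra_simps)
  qed
  \<comment> \<open>The squared lengths of the skew and the symmetric part of the conjugated
    operator, both applied to \<open>\<alpha>\<close> times \<open>exp (\<phi> / 2)\<close>.\<close>
  define G where "G x = exp (\<phi> x) * ((norm (d0 x + (p x / 2) *\<^sub>R \<alpha> x))\<^sup>2 + (norm (P x - (p x / 2) *\<^sub>R \<alpha> x))\<^sup>2)"
    for x
  have Pz: "P x = 0" if "x \<notin> K" for x by (simp add: P_def dz that)
  have cP: "continuous_on \<Omega> P" unfolding P_def [abs_def] by (intro cont)
  have intG: "integrable (lebesgue_on \<Omega>) G"
    unfolding G_def [abs_def]
    by (rule integrable_lebesgue_on_if_support [OF \<Omega>K]) (auto simp: K d0z Pz intro!: cont cP)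
  have intq: "integrable (lebesgue_on \<Omega>) (\<lambda>x. exp (\<phi> x) * (q x * (norm (\<alpha> x))\<^sup>2))"
    by (rule integrable_lebesgue_on_if_support [OF \<Omega>K]) (auto simp: K intro!: cont)
  have intD: "integrable (lebesgue_on \<Omega>) (\<lambda>x. exp (\<phi> x) * (norm (Dbar_right \<alpha> x))\<^sup>2)"
    unfolding D by (rule integrable_lebesgue_on_if_support [OF \<Omega>K]) (auto simp: d0z Pz intro!: cont cP)
  \<comment> \<open>The second derivatives cancel by \<open>commute\<close>; skewness of
    \<open>R j\<close> makes the two first-order products add up instead of cancelling.\<close>
  have sum23: "(\<Sum>j\<in>UNIV. h2' j x - h3' j x) = exp (\<phi> x) * (p x * (\<alpha> x \<bullet> P x) + 2 * (d0 x \<bullet> P x))" for x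
  proof -
    have "h2' j x - h3' j x = exp (\<phi> x) * (p x * (\<alpha> x \<bullet> R j (d j x)) + 2 * (d0 x \<bullet> R j (d j x)))" for j
      using inner_cl_mult_gen_skew [of "d j x" j "d0 x"]
      by (simp add: h2'_def h3'_def commute algebra_simps inner_commute flip: R_def)
    then show ?thesis
      by (simp add: P_def inner_sum_right distrib_left sum_distrib_left sum.distrib)
  qed
  have "exp (\<phi> x) * (norm (Dbar_right \<alpha> x))\<^sup>2 - exp (\<phi> x) * (q x * (norm (\<alpha> x))\<^sup>2) / 2
      = G x - h1' x / 2 + (\<Sum>j\<in>UNIV. h2' j x - h3' j x)" for x
    unfolding sum23 G_def h1'_def D
    using arg_cong [OF energy_identity [of "d0 x" "P x" "q x" "\<alpha> x" "p x"], of "\<lambda>y. exp (\<phi> x) * y"]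
    by (simp add: algebra_simps)
  then have "(LINT x|lebesgue_on \<Omega>.
        exp (\<phi> x) * (norm (Dbar_right \<alpha> x))\<^sup>2 - exp (\<phi> x) * (q x * (norm (\<alpha> x))\<^sup>2) / 2)
      = (LINT x|lebesgue_on \<Omega>. G x - h1' x / 2 + (\<Sum>j\<in>UNIV. h2' j x - h3' j x))"
    by simp
  also have "\<dots> = (LINT x|lebesgue_on \<Omega>. G x)"
    using intG int1 int2 int3 by (simp add: 1 2 3)
  also have "\<dots> \<ge> 0"
    by (rule Bochner_Integration.integral_nonneg) (simp add: G_def)
  finally show ?thesis
    using intD intq by simp
qed

section \<open>From weighted spaces to unweighted ones, and from scalar parts to the weak
  equation\<close>

text \<open>By openness \<open>g\<close> is constant near \<open>x\<close> along the line, so the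
  claim holds for \<open>\<psi>\<close> of any regularity.\<close>

lemma partial_eq_0_if_function_of_other_coordinate:
  fixes g :: "real ^ 'm \<Rightarrow> real"
  assumes "open \<Omega>" "x \<in> \<Omega>" "\<And>y. y \<in> \<Omega> \<Longrightarrow> g y = \<psi> (y $ k)" "i \<noteq> k"
  shows "((\<lambda>t. g (x + t *\<^sub>R axis i 1)) has_real_derivative 0) (at 0)"
proof -
  have "((\<lambda>t. x + t *\<^sub>R axis i (1::real)) \<longlongrightarrow> x + 0 *\<^sub>R axis i 1) (nhds 0)"
    by (intro tendsto_intros filterlim_ident)
  then have "\<forall>\<^sub>F t in nhds 0. x + t *\<^sub>R axis i (1::real) \<in> \<Omega>"
    using assms(1,2) by (intro topological_tendstoD) auto
  then have "\<forall>\<^sub>F t in nhds 0. g (x + t *\<^sub>R axis i 1) = \<psi> (x $ k)"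
    by eventually_elim (use assms in \<open>simp add: axis_def\<close>)
  from DERIV_cong_ev [OF refl this refl] show ?thesis by simp
qed

lemma integrable_norm_square_weighted:
  assumes "open \<Omega>" "continuous_on \<Omega> \<phi>" "f \<in> L2 \<Omega> \<phi>"
  shows "integrable (lebesgue_on \<Omega>) (\<lambda>x. (norm (exp (- \<phi> x / 2) *\<^sub>R f x))\<^sup>2)"
    and "(\<lambda>x. exp (- \<phi> x / 2) *\<^sub>R f x) \<in> borel_measurable (lebesgue_on \<Omega>)"
proof -
  have \<phi>[measurable]: "\<phi> \<in> borel_measurable (lebesgue_on \<Omega>)"
    using assms by (intro continuous_imp_measurable_on_sets_lebesgue) auto
  have f[measurable]: "f \<in> borel_measurable (lebesgue_on \<Omega>)"
    using assms(3) by (simp add: L2_def)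
  have fA: "(\<lambda>x. f x $ A) \<in> borel_measurable (lebesgue_on \<Omega>)" for A
    by (rule borel_measurable_continuous_on [OF _ f]) (intro continuous_intros)
  show "(\<lambda>x. exp (- \<phi> x / 2) *\<^sub>R f x) \<in> borel_measurable (lebesgue_on \<Omega>)" by measurable
  have "integrable (lebesgue_on \<Omega>) (\<lambda>x. \<bar>f x $ A\<bar>\<^sup>2 * exp (- \<phi> x))" for A
  proof (rule integrableI_nonneg)
    show "(\<lambda>x. \<bar>f x $ A\<bar>\<^sup>2 * exp (- \<phi> x)) \<in> borel_measurable (lebesgue_on \<Omega>)"
      using fA [of A] by measurable
  qed (use assms(3) in \<open>simp_all add: L2_def\<close>)
  then have "integrable (lebesgue_on \<Omega>) (\<lambda>x. \<Sum>A\<in>UNIV. \<bar>f x $ A\<bar>\<^sup>2 * exp (- \<phi> x))" by simp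
  moreover have "(\<Sum>A\<in>UNIV. \<bar>f x $ A\<bar>\<^sup>2 * exp (- \<phi> x)) = (norm (exp (- \<phi> x / 2) *\<^sub>R f x))\<^sup>2" for x
  proof -
    have "(exp (- \<phi> x / 2))\<^sup>2 = exp (- \<phi> x)" by (simp flip: exp_double)
    then show ?thesis
      by (simp add: power_mult_distrib norm_vec_def L2_set_def sum_nonneg sum_distrib_left mult.commute)
  qed
  ultimately show "integrable (lebesgue_on \<Omega>) (\<lambda>x. (norm (exp (- \<phi> x / 2) *\<^sub>R f x))\<^sup>2)" by simp
qed

text \<open>The weight is split as \<open>exp (\<phi> x / 2)\<close> on \<open>a\<close> and
  \<open>exp (- \<phi> x / 2)\<close> on \<open>f\<close>, which makes both factors
  square-integrable.\<close>

lemma integrable_inner_L2_weighted: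
  fixes a :: "real ^ 'n option \<Rightarrow> 'n::{finite,linorder} clifford"
  assumes \<Omega>: "open \<Omega>" "compact K" "K \<subseteq> \<Omega>" and "continuous_on \<Omega> \<phi>" "f \<in> L2 \<Omega> \<phi>"
    and a: "continuous_on \<Omega> a" "\<And>x. x \<notin> K \<Longrightarrow> a x = 0"
  shows "integrable (lebesgue_on \<Omega>) (\<lambda>x. a x \<bullet> f x)"
proof -
  have c: "continuous_on \<Omega> (\<lambda>x. exp (\<phi> x / 2) *\<^sub>R a x)"
    using assms by (intro continuous_intros) auto
  have "(\<lambda>x. exp (\<phi> x / 2) *\<^sub>R a x) \<in> borel_measurable (lebesgue_on \<Omega>)"
    using c \<open>open \<Omega>\<close> by (intro continuous_imp_measurable_on_sets_lebesgue) auto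
  moreover have "integrable (lebesgue_on \<Omega>) (\<lambda>x. (norm (exp (\<phi> x / 2) *\<^sub>R a x))\<^sup>2)"
  proof (rule integrable_lebesgue_on_if_support [OF \<Omega>])
    show "continuous_on \<Omega> (\<lambda>x. (norm (exp (\<phi> x / 2) *\<^sub>R a x))\<^sup>2)"
      by (intro continuous_on_power continuous_on_norm c)
  qed (simp add: a(2))
  ultimately have "integrable (lebesgue_on \<Omega>)
      (\<lambda>x. (exp (\<phi> x / 2) *\<^sub>R a x) \<bullet> (exp (- \<phi> x / 2) *\<^sub>R f x))"
    using integrable_norm_square_weighted [OF \<open>open \<Omega>\<close> assms(4,5)] by (intro integrable_inner_L2)
  moreover have "(exp (\<phi> x / 2) *\<^sub>R a x) \<bullet> (exp (- \<phi> x / 2) *\<^sub>R f x) = a x \<bullet> f x" for x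
    by (simp add: exp_minus)
  ultimately show ?thesis by (simp only:)
qed

lemma integrable_cl_mult:
  fixes a :: "real ^ 'n option \<Rightarrow> 'n::{finite,linorder} clifford"
  assumes "open \<Omega>" "compact K" "K \<subseteq> \<Omega>" "continuous_on \<Omega> \<phi>" "f \<in> L2 \<Omega> \<phi>"
    and a: "continuous_on \<Omega> a" "\<And>x. x \<notin> K \<Longrightarrow> a x = 0"
  shows "integrable (lebesgue_on \<Omega>) (\<lambda>x. a x \<otimes>\<^sub>c f x)"
proof -
  have "integrable (lebesgue_on \<Omega>) (\<lambda>x. cl_twist (cl_basis C \<otimes>\<^sub>c a x) \<bullet> f x)" for C
    by (rule integrable_inner_L2_weighted [OF assms(1-5)])
      (auto simp: a(2) bilinear_rzero [OF bilinear_cl_mult] linear_0 [OF linear_cl_twist]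
        intro!: bounded_linear.continuous_on [OF bounded_linear_cl_twist]
          bounded_linear.continuous_on [OF bounded_linear_cl_mult_right] a(1))
  then have "integrable (lebesgue_on \<Omega>) (\<lambda>x. (a x \<otimes>\<^sub>c f x) $ C)" for C
    unfolding cl_mult_nth_eq_inner by simp
  then show ?thesis by (subst cl_expand) auto
qed

lemma integral_nth_cl_mult:
  assumes "integrable M (\<lambda>x. a x \<otimes>\<^sub>c f x)"
  shows "(LINT x|M. a x \<otimes>\<^sub>c f x) $ C
    = cl_sign C C * (LINT x|M. cl_twist (cl_basis C \<otimes>\<^sub>c a x) \<bullet> f x)"
proof -
  have "(LINT x|M. a x \<otimes>\<^sub>c f x) $ C = (LINT x|M. (a x \<otimes>\<^sub>c f x) $ C)"
    using integral_bounded_linear [OF bounded_linear_vec_nth assms] by simp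
  then show ?thesis by (simp add: cl_mult_nth_eq_inner)
qed

text \<open>Applying \<open>scalar\<close> to the test function \<open>cl_basis C\<close> times
  \<open>\<alpha>\<close> gives coordinate \<open>C\<close> of the Clifford-valued equation.\<close>

lemma weak_Dbar_solutionI:
  fixes f u :: "real ^ 'n option \<Rightarrow> 'n::{finite,linorder} clifford"
  assumes \<Omega>: "open \<Omega>" and \<phi>: "continuous_on \<Omega> \<phi>" and f: "f \<in> L2 \<Omega> \<phi>" and u: "u \<in> L2 \<Omega> \<phi>"
    and scalar: "\<And>\<alpha>. \<alpha> \<in> test_functions \<Omega> \<Longrightarrow>
      (LINT x|lebesgue_on \<Omega>. cl_twist (\<alpha> x) \<bullet> f x)
        = - (LINT x|lebesgue_on \<Omega>. cl_twist (Dbar_right \<alpha> x) \<bullet> u x)"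
  shows "weak_Dbar_solution \<Omega> u f"
  unfolding weak_Dbar_solution_def
proof
  fix \<alpha> :: "real ^ 'n option \<Rightarrow> 'n clifford"
  assume \<alpha>: "\<alpha> \<in> test_functions \<Omega>"
  then obtain K where K: "compact K" "K \<subseteq> \<Omega>" "\<And>x. x \<notin> K \<Longrightarrow> \<alpha> x = 0" and s: "smooth \<alpha>"
    unfolding test_functions_iff by blast
  \<comment> \<open>Integrability permits taking coordinates under the integral sign.\<close>
  have "integrable (lebesgue_on \<Omega>) (\<lambda>x. \<alpha> x \<otimes>\<^sub>c f x)"
    by (rule integrable_cl_mult [OF \<Omega> K(1,2) \<phi> f smooth_continuous [OF s] K(3)])
  moreover have "integrable (lebesgue_on \<Omega>) (\<lambda>x. Dbar_right \<alpha> x \<otimes>\<^sub>c u x)"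
    by (rule integrable_cl_mult [OF \<Omega> K(1,2) \<phi> u continuous_on_Dbar_right [OF s]
          Dbar_right_eq_0_outside [OF K(1,3)]])
  moreover have "(LINT x|lebesgue_on \<Omega>. cl_twist (cl_basis C \<otimes>\<^sub>c \<alpha> x) \<bullet> f x)
      = - (LINT x|lebesgue_on \<Omega>. cl_twist (cl_basis C \<otimes>\<^sub>c Dbar_right \<alpha> x) \<bullet> u x)" for C
    using scalar [OF test_functions_cl_basis_mult [OF \<alpha>], of C]
    by (simp add: Dbar_right_cl_basis_mult [OF s])
  ultimately show "(LINT x|lebesgue_on \<Omega>. \<alpha> x \<otimes>\<^sub>c f x)
      = - (LINT x|lebesgue_on \<Omega>. Dbar_right \<alpha> x \<otimes>\<^sub>c u x)"
    by (simp add: vec_eq_iff integral_nth_cl_mult)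
qed

text \<open>Where \<open>q x = 0\<close> the density \<open>F\<close> is zero, because \<open>c / 0 = 0\<close> in the reals.\<close>

lemma weighted_energy_density:
  fixes f :: "real ^ 'n option \<Rightarrow> 'n::{finite,linorder} clifford"
  assumes "open \<Omega>" "continuous_on \<Omega> \<phi>" "continuous_on \<Omega> q" "\<forall>x\<in>\<Omega>. 0 \<le> q x"
    and "f \<in> borel_measurable (lebesgue_on \<Omega>)" and fin: "weighted_energy \<Omega> \<phi> q f < \<infinity>"
    and F_eq: "\<And>x. F x = (exp (- \<phi> x / 2) / sqrt (q x)) *\<^sub>R f x"
  shows "F \<in> borel_measurable (lebesgue_on \<Omega>)"
    and "integrable (lebesgue_on \<Omega>) (\<lambda>x. (norm (F x))\<^sup>2)"
    and "ennreal (2 ^ CARD('n) * (LINT x|lebesgue_on \<Omega>. (norm (F x))\<^sup>2)) \<le> weighted_energy \<Omega> \<phi> q f"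
    and "AE x in lebesgue_on \<Omega>. q x = 0 \<longrightarrow> f x = 0"
proof -
  have \<phi>[measurable]: "\<phi> \<in> borel_measurable (lebesgue_on \<Omega>)"
    using assms by (intro continuous_imp_measurable_on_sets_lebesgue) auto
  have q[measurable]: "q \<in> borel_measurable (lebesgue_on \<Omega>)"
    using assms by (intro continuous_imp_measurable_on_sets_lebesgue) auto
  note f[measurable] = assms(5)
  show F[measurable]: "F \<in> borel_measurable (lebesgue_on \<Omega>)" unfolding F_eq [abs_def] by measurable
  define W where "W x = ennreal ((cl_norm (f x))\<^sup>2) / ennreal (q x) * ennreal (exp (- \<phi> x))" for x
  have W: "W \<in> borel_measurable (lebesgue_on \<Omega>)"
    unfolding W_def cl_norm_square by measurable
  have E: "weighted_energy \<Omega> \<phi> q f = (\<integral>\<^sup>+x. W x \<partial>lebesgue_on \<Omega>)"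
    by (simp add: weighted_energy_def W_def)
  \<comment> \<open>Finite energy excludes the value infinity up to a null set, and \<open>W\<close>
    is infinite wherever \<open>q x = 0\<close> and \<open>f x\<close> is nonzero.\<close>
  have "AE x in lebesgue_on \<Omega>. W x \<noteq> \<infinity>"
    using fin W unfolding E by (intro nn_integral_PInf_AE) auto
  then show "AE x in lebesgue_on \<Omega>. q x = 0 \<longrightarrow> f x = 0"
  proof eventually_elim
    case (elim x)
    show ?case
    proof (intro impI, rule ccontr)
      assume "q x = 0" "f x \<noteq> 0"
      then have "ennreal ((cl_norm (f x))\<^sup>2) / ennreal (q x) = \<infinity>"
        by (simp add: cl_norm_square ennreal_divide_eq_top_iff)
      with elim show False by (simp add: W_def ennreal_top_mult)
    qed
  qed
  have le: "ennreal (2 ^ CARD('n) * (norm (F x))\<^sup>2) \<le> W x" if "x \<in> \<Omega>" for x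
  proof (cases "q x = 0")
    case True
    then show ?thesis by (simp add: F_eq)
  next
    case False
    with assms(4) that have "q x > 0" by force
    moreover have "(exp (- \<phi> x / 2))\<^sup>2 = exp (- \<phi> x)" by (simp flip: exp_double)
    ultimately show ?thesis
      by (simp add: W_def F_eq cl_norm_square power_mult_distrib power_divide
          divide_ennreal mult_ac flip: ennreal_mult)
  qed
  have *: "(\<integral>\<^sup>+x. ennreal (2 ^ CARD('n) * (norm (F x))\<^sup>2) \<partial>lebesgue_on \<Omega>) \<le> weighted_energy \<Omega> \<phi> q f"
    unfolding E by (rule nn_integral_mono) (use le in simp)
  have i: "integrable (lebesgue_on \<Omega>) (\<lambda>x. 2 ^ CARD('n) * (norm (F x))\<^sup>2)"
    by (rule integrableI_nonneg) (use * fin in \<open>auto intro: le_less_trans\<close>)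
  then show "integrable (lebesgue_on \<Omega>) (\<lambda>x. (norm (F x))\<^sup>2)" by simp
  show "ennreal (2 ^ CARD('n) * (LINT x|lebesgue_on \<Omega>. (norm (F x))\<^sup>2)) \<le> weighted_energy \<Omega> \<phi> q f"
    using * unfolding nn_integral_eq_integral [OF i, simplified] by simp
qed

section \<open>Duality and construction of the solution\<close>

theorem corollary1p4:
  fixes \<Omega> :: "(real ^ ('n::{finite,linorder}) option) set"
    and \<phi> :: "real ^ 'n option \<Rightarrow> real"
    and f :: "real ^ 'n option \<Rightarrow> 'n clifford"
  assumes "open \<Omega>"
    and "C_on 2 \<Omega> \<phi>"
    and "\<exists>\<psi>. \<forall>x\<in>\<Omega>. \<phi> x = \<psi> (x $ None)"
    and "\<forall>x\<in>\<Omega>. partial None (partial None \<phi>) x \<ge> 0"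
    and "f \<in> L2 \<Omega> \<phi>"
    and "weighted_energy \<Omega> \<phi> (partial None (partial None \<phi>)) f < \<infinity>"
  shows "\<exists>u \<in> L2 \<Omega> \<phi>. weak_Dbar_solution \<Omega> u f \<and>
    ennreal ((L2_norm \<Omega> \<phi> u)\<^sup>2)
      \<le> 2 ^ (2 * CARD('n)) * weighted_energy \<Omega> \<phi> (partial None (partial None \<phi>)) f"
proof -
  define M where "M = lebesgue_on \<Omega>"
  define p where "p = partial None \<phi>"
  define q where "q = partial None p"
  define E where "E = weighted_energy \<Omega> \<phi> q f"
  have diff: "\<phi> differentiable_on \<Omega>" "p differentiable_on \<Omega>" and cq: "continuous_on \<Omega> q"
    using assms(2) by (auto simp: numeral_2_eq_2 p_def q_def)
  have c\<phi>: "continuous_on \<Omega> \<phi>" and cp: "continuous_on \<Omega> p"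
    using diff by (auto intro: differentiable_imp_continuous_on)
  have diff_at: "\<phi> differentiable (at x)" "p differentiable (at x)" if "x \<in> \<Omega>" for x
    using diff that \<open>open \<Omega>\<close> by (auto simp: differentiable_on_eq_differentiable_at)
  have \<phi>0: "((\<lambda>t. \<phi> (x + t *\<^sub>R axis None 1)) has_real_derivative p x) (at 0)"
    and p0: "((\<lambda>t. p (x + t *\<^sub>R axis None 1)) has_real_derivative q x) (at 0)" if "x \<in> \<Omega>" for x
    unfolding p_def q_def using diff_at [OF that] by (auto intro: DERIV_partial simp: p_def)
  obtain \<psi> where \<psi>: "\<And>x. x \<in> \<Omega> \<Longrightarrow> \<phi> x = \<psi> (x $ None)" using assms(3) by blast
  have \<phi>j: "((\<lambda>t. \<phi> (x + t *\<^sub>R axis (Some j) 1)) has_real_derivative 0) (at 0)" if "x \<in> \<Omega>" for x j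
    using \<open>open \<Omega>\<close> that \<psi> by (rule partial_eq_0_if_function_of_other_coordinate) auto
  have q0: "\<forall>x\<in>\<Omega>. 0 \<le> q x" using assms(4) by (simp add: p_def q_def)
  have fM[measurable]: "f \<in> borel_measurable M" using assms(5) by (simp add: L2_def M_def)
  have \<phi>M[measurable]: "\<phi> \<in> borel_measurable M"
    unfolding M_def using c\<phi> \<open>open \<Omega>\<close> by (intro continuous_imp_measurable_on_sets_lebesgue) auto
  define F where "F x = (exp (- \<phi> x / 2) / sqrt (q x)) *\<^sub>R f x" for x
  have fin: "weighted_energy \<Omega> \<phi> q f < \<infinity>" using assms(6) by (simp add: p_def q_def)
  note F = weighted_energy_density [OF \<open>open \<Omega>\<close> c\<phi> cq q0 fM [unfolded M_def] fin
      F_def, folded M_def E_def]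
  define N where "N = (LINT x|M. (norm (F x))\<^sup>2)"
  have N0: "0 \<le> N" by (simp add: N_def)
  \<comment> \<open>The factor \<open>exp (\<phi> x / 2)\<close> makes the weighted norm an
    unweighted one; the twist makes inner products with \<open>v \<alpha>\<close> scalar parts of
    Clifford products.\<close>
  define v where "v \<alpha> x = exp (\<phi> x / 2) *\<^sub>R cl_twist (Dbar_right \<alpha> x)" for \<alpha> x
  define \<rho> where "\<rho> \<alpha> = - (LINT x|M. cl_twist (\<alpha> x) \<bullet> f x)" for \<alpha>
  \<comment> \<open>Using pairs postpones well-definedness of the functional, which is contained in
    \<open>\<rho>_bound\<close>: a vanishing \<open>v \<alpha>\<close> forces
    \<open>\<rho> \<alpha> = 0\<close>.\<close>
  define S where "S = (\<lambda>\<alpha>. (v \<alpha>, \<rho> \<alpha>)) ` test_functions \<Omega>"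
  have exp2: "(exp (\<phi> x / 2))\<^sup>2 = exp (\<phi> x)" for x by (simp flip: exp_double)
  have norm_v: "(norm (v \<alpha> x))\<^sup>2 = exp (\<phi> x) * (norm (Dbar_right \<alpha> x))\<^sup>2" for \<alpha> x
    by (simp add: v_def power_mult_distrib exp2)
  have v: "v \<alpha> \<in> borel_measurable M" "integrable M (\<lambda>x. (norm (v \<alpha> x))\<^sup>2)"
    and int_f: "integrable M (\<lambda>x. cl_twist (\<alpha> x) \<bullet> f x)"
    and \<rho>_bound: "(\<rho> \<alpha>)\<^sup>2 \<le> 2 * N * (LINT x|M. (norm (v \<alpha> x))\<^sup>2)"
    if \<alpha>: "\<alpha> \<in> test_functions \<Omega>" for \<alpha>
  proof -
    obtain K where K: "compact K" "K \<subseteq> \<Omega>" "\<And>x. x \<notin> K \<Longrightarrow> \<alpha> x = 0" and s: "smooth \<alpha>"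
      using \<alpha> unfolding test_functions_iff by blast
    note \<Omega>K = \<open>open \<Omega>\<close> K(1,2)
    have cv: "continuous_on \<Omega> (v \<alpha>)"
      unfolding v_def [abs_def]
      by (intro continuous_on_scaleR continuous_on_exp continuous_on_divide c\<phi> continuous_on_const
          bounded_linear.continuous_on [OF bounded_linear_cl_twist] continuous_on_Dbar_right s) simp
    then show "v \<alpha> \<in> borel_measurable M"
      unfolding M_def using \<open>open \<Omega>\<close> by (intro continuous_imp_measurable_on_sets_lebesgue) auto
    show "integrable M (\<lambda>x. (norm (v \<alpha> x))\<^sup>2)"
      unfolding M_def
    proof (rule integrable_lebesgue_on_if_support [OF \<Omega>K])
      show "continuous_on \<Omega> (\<lambda>x. (norm (v \<alpha> x))\<^sup>2)" by (intro continuous_intros cv)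
    qed (simp add: norm_v Dbar_right_eq_0_outside [OF K(1,3)])
    show "integrable M (\<lambda>x. cl_twist (\<alpha> x) \<bullet> f x)"
      unfolding M_def
      by (rule integrable_inner_L2_weighted [OF \<Omega>K c\<phi> assms(5)])
        (auto simp: K(3) linear_0 [OF linear_cl_twist]
          intro!: bounded_linear.continuous_on [OF bounded_linear_cl_twist] smooth_continuous [OF s])
    \<comment> \<open>The partner of \<open>F\<close> in Cauchy-Schwarz: the weights cancel in the
      inner product where \<open>q x > 0\<close>, and where \<open>q x = 0\<close> both sides vanish
      almost everywhere because \<open>f\<close> does.\<close>
    define b where "b x = (exp (\<phi> x / 2) * sqrt (q x)) *\<^sub>R cl_twist (\<alpha> x)" for x
    have norm_b: "(norm (b x))\<^sup>2 = exp (\<phi> x) * (q x * (norm (\<alpha> x))\<^sup>2)" if "x \<in> \<Omega>" for x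
      using q0 that by (simp add: b_def power_mult_distrib exp2)
    have cb: "continuous_on \<Omega> b"
      unfolding b_def [abs_def]
      by (intro continuous_on_scaleR continuous_on_mult continuous_on_exp continuous_on_divide c\<phi>
          continuous_on_const continuous_on_real_sqrt cq
          bounded_linear.continuous_on [OF bounded_linear_cl_twist] smooth_continuous [OF s]) simp
    have bM: "b \<in> borel_measurable M"
      unfolding M_def using cb \<open>open \<Omega>\<close> by (intro continuous_imp_measurable_on_sets_lebesgue) auto
    have bI: "integrable M (\<lambda>x. (norm (b x))\<^sup>2)"
      unfolding M_def
    proof (rule integrable_lebesgue_on_if_support [OF \<Omega>K])
      show "continuous_on \<Omega> (\<lambda>x. (norm (b x))\<^sup>2)" by (intro continuous_intros cb)
    qed (simp add: b_def K(3))
    have "(LINT x|M. cl_twist (\<alpha> x) \<bullet> f x) = (LINT x|M. b x \<bullet> F x)"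
    proof (rule integral_cong_AE)
      show "(\<lambda>x. cl_twist (\<alpha> x) \<bullet> f x) \<in> borel_measurable M"
        using \<open>integrable M (\<lambda>x. cl_twist (\<alpha> x) \<bullet> f x)\<close> by simp
      show "(\<lambda>x. b x \<bullet> F x) \<in> borel_measurable M" using bM F(1) by measurable
      have "AE x in M. x \<in> \<Omega>" unfolding M_def by (rule AE_I2) simp
      with F(4) show "AE x in M. cl_twist (\<alpha> x) \<bullet> f x = b x \<bullet> F x"
      proof eventually_elim
        case (elim x)
        then show ?case
          using q0 by (cases "q x = 0") (auto simp: b_def F_def exp_minus)
      qed
    qed
    then have "(\<rho> \<alpha>)\<^sup>2 \<le> (LINT x|M. (norm (b x))\<^sup>2) * N"
      using Cauchy_Schwarz_L2 [OF bM F(1) bI F(2)] by (simp add: \<rho>_def N_def)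
    also have "(LINT x|M. (norm (b x))\<^sup>2) = (LINT x|M. exp (\<phi> x) * (q x * (norm (\<alpha> x))\<^sup>2))"
      by (rule Bochner_Integration.integral_cong) (auto simp: norm_b M_def)
    \<comment> \<open>The a priori inequality contributes the factor 2 in the Riesz constant
      \<open>2 * N\<close>.\<close>
    also have "\<dots> \<le> 2 * (LINT x|M. (norm (v \<alpha> x))\<^sup>2)"
      unfolding norm_v M_def
      by (rule Dbar_right_energy [OF \<open>open \<Omega>\<close> \<alpha> \<phi>0 \<phi>j p0 c\<phi> cp cq])
    finally show "(\<rho> \<alpha>)\<^sup>2 \<le> 2 * N * (LINT x|M. (norm (v \<alpha> x))\<^sup>2)"
      using N0 by (simp add: mult_right_mono mult_ac)
  qed
  obtain g where gM[measurable]: "g \<in> borel_measurable M" and gI: "integrable M (\<lambda>x. (norm (g x))\<^sup>2)"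
    and g_le: "(LINT x|M. (norm (g x))\<^sup>2) \<le> 2 * N"
    and g: "\<And>w r. (w, r) \<in> S \<Longrightarrow> (LINT x|M. w x \<bullet> g x) = r"
  proof (rule L2_Riesz [of S M "2 * N"])
    fix w w' r r' and a b :: real
    assume "(w, r) \<in> S" "(w', r') \<in> S"
    then obtain \<alpha> \<beta> where w: "w = v \<alpha>" "r = \<rho> \<alpha>" "w' = v \<beta>" "r' = \<rho> \<beta>"
      and \<alpha>: "\<alpha> \<in> test_functions \<Omega>" and \<beta>: "\<beta> \<in> test_functions \<Omega>" by (auto simp: S_def)
    define \<gamma> where "\<gamma> x = a *\<^sub>R \<alpha> x + b *\<^sub>R \<beta> x" for x
    have "\<gamma> \<in> test_functions \<Omega>"
      unfolding \<gamma>_def [abs_def] by (rule test_functions_linear_combination [OF \<alpha> \<beta>])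
    moreover have "v \<gamma> x = a *\<^sub>R w x + b *\<^sub>R w' x" for x
    proof -
      have "Dbar_right \<gamma> x = a *\<^sub>R Dbar_right \<alpha> x + b *\<^sub>R Dbar_right \<beta> x"
        using \<alpha> \<beta> unfolding \<gamma>_def [abs_def] test_functions_iff
        by (intro Dbar_right_linear_combination) auto
      then show ?thesis
        by (simp add: v_def w linear_add [OF linear_cl_twist] linear_cmul [OF linear_cl_twist]
            scaleR_add_right mult.commute)
    qed
    moreover have "\<rho> \<gamma> = a * r + b * r'"
      using int_f [OF \<alpha>] int_f [OF \<beta>]
      by (simp add: \<rho>_def \<gamma>_def w linear_add [OF linear_cl_twist] linear_cmul [OF linear_cl_twist]
          inner_add_left)
    ultimately show "((\<lambda>x. a *\<^sub>R w x + b *\<^sub>R w' x), a * r + b * r') \<in> S"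
      unfolding S_def by (intro image_eqI [of _ _ \<gamma>]) auto
  next
    \<comment> \<open>The zero function, with empty support, is admissible even if
      \<open>\<Omega>\<close> is empty.\<close>
    have "(\<lambda>x. 0) \<in> test_functions \<Omega>"
      unfolding test_functions_iff smooth_def
      by (intro conjI allI exI [of _ "{}"]) (auto intro: C_on_zero)
    then show "S \<noteq> {}" by (auto simp: S_def)
  qed (use v \<rho>_bound N0 that in \<open>auto simp: S_def\<close>)
  \<comment> \<open>Undoes the passage to the unweighted space, so that the inner product of
    \<open>v \<alpha> x\<close> and \<open>g x\<close> is that of
    \<open>cl_twist (Dbar_right \<alpha> x)\<close> and \<open>u x\<close>.\<close>
  define u where "u x = exp (\<phi> x / 2) *\<^sub>R g x" for x
  have uM[measurable]: "u \<in> borel_measurable M" unfolding u_def by measurable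
  have norm_u: "(norm (u x))\<^sup>2 * exp (- \<phi> x) = (norm (g x))\<^sup>2" for x
    by (simp add: u_def power_mult_distrib exp2 exp_minus)
  have "u \<in> L2 \<Omega> \<phi>"
  proof -
    have "(\<integral>\<^sup>+x. ennreal (\<bar>u x $ A\<bar>\<^sup>2 * exp (- \<phi> x)) \<partial>M) \<le> (\<integral>\<^sup>+x. ennreal ((norm (g x))\<^sup>2) \<partial>M)" for A
      unfolding norm_u [symmetric]
      by (intro nn_integral_mono ennreal_leI mult_right_mono power_mono component_le_norm_cart) auto
    moreover have "(\<integral>\<^sup>+x. ennreal ((norm (g x))\<^sup>2) \<partial>M) < \<infinity>"
      by (subst nn_integral_eq_integral [OF gI]) auto
    ultimately show ?thesis
      using uM unfolding L2_def M_def by (auto intro: le_less_trans)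
  qed
  moreover have "weak_Dbar_solution \<Omega> u f"
  proof (rule weak_Dbar_solutionI [OF \<open>open \<Omega>\<close> c\<phi> assms(5) \<open>u \<in> L2 \<Omega> \<phi>\<close>])
    fix \<alpha> :: "real ^ 'n option \<Rightarrow> 'n clifford" assume "\<alpha> \<in> test_functions \<Omega>"
    then have "(LINT x|M. v \<alpha> x \<bullet> g x) = \<rho> \<alpha>" by (intro g) (simp add: S_def)
    then show "(LINT x|lebesgue_on \<Omega>. cl_twist (\<alpha> x) \<bullet> f x)
        = - (LINT x|lebesgue_on \<Omega>. cl_twist (Dbar_right \<alpha> x) \<bullet> u x)"
      by (simp add: v_def \<rho>_def u_def M_def)
  qed
  moreover have "ennreal ((L2_norm \<Omega> \<phi> u)\<^sup>2) \<le> 2 ^ (2 * CARD('n)) * E"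
  proof -
    have "(L2_norm \<Omega> \<phi> u)\<^sup>2 = 2 ^ CARD('n) * (LINT x|M. (norm (g x))\<^sup>2)"
      unfolding L2_norm_def cl_norm_square mult.assoc norm_u M_def by simp
    also have "\<dots> \<le> 2 * (2 ^ CARD('n) * N)" using g_le by simp
    finally have "ennreal ((L2_norm \<Omega> \<phi> u)\<^sup>2) \<le> ennreal (2 * (2 ^ CARD('n) * N))"
      by (rule ennreal_leI)
    also have "\<dots> = 2 * ennreal (2 ^ CARD('n) * N)"
      using N0 by (simp add: ennreal_mult)
    also have "\<dots> \<le> 2 * E" using F(3) unfolding N_def by (rule mult_left_mono) simp
    also have "\<dots> \<le> 2 ^ (2 * CARD('n)) * E"
    proof (rule mult_right_mono)
      \<comment> \<open>Uses that there is at least one generator, as the index type is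
        nonempty.\<close>
      have "(2::ennreal) ^ 1 \<le> 2 ^ (2 * CARD('n))" by (rule power_increasing) auto
      then show "(2::ennreal) \<le> 2 ^ (2 * CARD('n))" by simp
    qed simp
    finally show ?thesis .
  qed
  ultimately show ?thesis unfolding E_def p_def q_def by blast
qed

end
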